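(* Let $H$ be a linear cycle set and let $I$ be an abelian group endowed with a map $\diamond\colon H\times I\to I$ such that, for all $h,h'\in H$ and $y,y'\in I$, $(h'h)\diamond y=h\diamond(h'\diamond y)$, $h\diamond(y+y')=h\diamond y+h\diamond y'$ and $0\diamond y=y$. Then the diagram $\bigl(\widehat{C}_N^{**}(H,I),\partial_{\mathrm h}^{**},\partial_{\mathrm v}^{**}\bigr)$ is a double cochain complex, that is, wherever the compositions are defined, $\partial_{\mathrm v}\circ\partial_{\mathrm v}=0$, $\partial_{\mathrm h}\circ\partial_{\mathrm h}=0$ and $\partial_{\mathrm v}\circ\partial_{\mathrm h}=-\partial_{\mathrm h}\circ\partial_{\mathrm v}$.
   Context: A linear cycle set is an abelian group $(A,+)$ with a binary operation $\cdot$ such that for each $b\in A$ the map $a\mapsto b\cdot a$ is bijective, and $a\cdot(b+c)=a\cdot b+a\cdot c$ and $(a+b)\cdot c=(a\cdot b)\cdot(a\cdot c)$ for all $a,b,c$. It carries a multiplication $ab={}^ab+a$, where $b\mapsto{}^ab$ is the inverse of $b\mapsto a\cdot b$; this is a group operation with neutral element $0$. Let $\overline H=H\setminus\{0\}$. For $s\ge1$ let $\mathbb Z[\overline H^s]$ be the free abelian group on $\overline H^s$ (and $\mathbb Z[\overline H^0]=\mathbb Z$), and let $\mathrm{sh}(\mathbb Z[\overline H^s])$ be the subgroup generated by the shuffles $\sum_{\sigma\in\mathrm{sh}_{l,s-l}}\mathrm{sg}(\sigma)(h_{\sigma^{-1}(1)},\dots,h_{\sigma^{-1}(s)})$, for $1\le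 l<s$ and $h_k\in\overline H$, where $\mathrm{sh}_{l,s-l}$ is the set of permutations $\sigma$ of $\{1,\dots,s\}$ with $\sigma(1)<\dots<\sigma(l)$ and $\sigma(l+1)<\dots<\sigma(s)$. Put $\overline M(s)=\mathbb Z[\overline H^s]/\mathrm{sh}(\mathbb Z[\overline H^s])$ and denote by $[h_1,\dots,h_s]$ the class of $(h_1,\dots,h_s)$. For $r\ge0$, $s\ge1$ let $\widehat C_N^{rs}(H,I)=\mathrm{Hom}(\mathbb Z[\overline H^r]\otimes\overline M(s),I)$. We write $f(h_1,\dots,h_r,[h_{r+1},\dots,h_{r+s}])$ for the value of $f$ on $(h_1,\dots,h_r)\otimes[h_{r+1},\dots,h_{r+s}]$; by convention this value is $0$ if some $h_i=0$. For $r\ge0$ let $R_{r1}(h_1,\dots,h_{r+1})=(h_1+\dots+h_r)\cdot h_{r+1}\in H$ (so $R_{01}(h_1)=h_1$). The maps $\partial_{\mathrm h}^{r+1,s}\colon\widehat C_N^{rs}(H,I)\to\widehat C_N^{r+1,s}(H,I)$ and $\partial_{\mathrm v}^{r,s+1}\colon\widehat C_N^{rs}(H,I)\to\widehat C_N^{r,s+1}(H,I)$ are \begin{align*} \partial_{\mathrm h}^{r+1,s}(f)(h_1,\dots,h_{r+1},[h_{r+2},\dots,h_{r+s+1}])&=f(h_1\cdot h_2,\dots,h_1\cdot h_{r+1},[h_1\cdot h_{r+2},\dots,h_1\cdot h_{r+s+1}])\\ &+\sum_{j=1}^r(-1)^jf(h_1,\dots,h_{j-1},h_j+h_{j+1},h_{j+2},\dots,h_{r+1},[h_{r+2},\dots,h_{r+s+1}])\\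 &+(-1)^{r+1}R_{r1}(h_1,\dots,h_{r+1})\diamond f(h_1,\dots,h_r,[h_{r+2},\dots,h_{r+s+1}]),\\ \partial_{\mathrm v}^{r,s+1}(f)(h_1,\dots,h_r,[h_{r+1},\dots,h_{r+s+1}])&=(-1)^rf(h_1,\dots,h_r,[h_{r+2},\dots,h_{r+s+1}])\\ &+\sum_{j=r+1}^{r+s}(-1)^jf(h_1,\dots,h_r,[h_{r+1},\dots,h_{j-1},h_j+h_{j+1},h_{j+2},\dots,h_{r+s+1}])\\ &+(-1)^{r+s+1}f(h_1,\dots,h_r,[h_{r+1},\dots,h_{r+s}]). \end{align*} *)

theory Defs
  imports
    "HOL-Algebra.Free_Abelian_Groups"
    "HOL-Algebra.Generated_Groups"
    "HOL-Combinatorics.Permutations"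
begin

section \<open>Linear cycle sets\<close>

locale linear_cycle_set =
  fixes dot :: "'h::ab_group_add \<Rightarrow> 'h \<Rightarrow> 'h"
  assumes bij_dot: "bij (dot b)"
    and dot_add_right: "dot a (b + c) = dot a b + dot a c"
    and dot_add_left: "dot (a + b) c = dot (dot a b) (dot a c)"

text \<open>HOL-Algebra reserves the prefix \<open>inv\<close> for group inverses, hence \<^const>\<open>inv_into\<close>
  for inverse functions throughout.\<close>

definition lcs_mult :: "('h::ab_group_add \<Rightarrow> 'h \<Rightarrow> 'h) \<Rightarrow> 'h \<Rightarrow> 'h \<Rightarrow> 'h" where
  "lcs_mult dot a b = inv_into UNIV (dot a) b + a"


section \<open>Tensor products and groups of homomorphisms\<close>

definition additive_group :: "'i::ab_group_add monoid" where
  "additive_group = \<lparr>carrier = UNIV, monoid.mult = (+), one = 0\<rparr>"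

definition tensor_relations ::
  "('a, 'm) monoid_scheme \<Rightarrow> ('b, 'n) monoid_scheme \<Rightarrow> ('a \<times> 'b \<Rightarrow>\<^sub>0 int) set" where
  "tensor_relations G K =
     {frag_of (x \<otimes>\<^bsub>G\<^esub> x', y) - frag_of (x, y) - frag_of (x', y) | x x' y.
        x \<in> carrier G \<and> x' \<in> carrier G \<and> y \<in> carrier K} \<union>
     {frag_of (x, y \<otimes>\<^bsub>K\<^esub> y') - frag_of (x, y) - frag_of (x, y') | x y y'.
        x \<in> carrier G \<and> y \<in> carrier K \<and> y' \<in> carrier K}"

definition tensor_kernel ::
  "('a, 'm) monoid_scheme \<Rightarrow> ('b, 'n) monoid_scheme \<Rightarrow> ('a \<times> 'b \<Rightarrow>\<^sub>0 int) set" where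
  "tensor_kernel G K =
     generate (free_Abelian_group (carrier G \<times> carrier K)) (tensor_relations G K)"

definition tensor_group ::
  "('a, 'm) monoid_scheme \<Rightarrow> ('b, 'n) monoid_scheme \<Rightarrow> ('a \<times> 'b \<Rightarrow>\<^sub>0 int) set monoid" where
  "tensor_group G K = free_Abelian_group (carrier G \<times> carrier K) Mod tensor_kernel G K"

definition pure_tensor ::
  "('a, 'm) monoid_scheme \<Rightarrow> ('b, 'n) monoid_scheme \<Rightarrow> 'a \<Rightarrow> 'b \<Rightarrow> ('a \<times> 'b \<Rightarrow>\<^sub>0 int) set" where
  "pure_tensor G K x y =
     tensor_kernel G K #>\<^bsub>free_Abelian_group (carrier G \<times> carrier K)\<^esub> frag_of (x, y)"

text \<open>Homomorphisms are taken extensional, so that two of them are equal as HOL functions as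
  soon as they agree on the carrier of the source.\<close>

definition hom_group ::
  "('a, 'm) monoid_scheme \<Rightarrow> ('b, 'n) monoid_scheme \<Rightarrow> ('a \<Rightarrow> 'b) monoid" where
  "hom_group G K =
     \<lparr>carrier = hom G K \<inter> extensional (carrier G),
      monoid.mult = (\<lambda>f g. \<lambda>x\<in>carrier G. f x \<otimes>\<^bsub>K\<^esub> g x),
      one = (\<lambda>x\<in>carrier G. \<one>\<^bsub>K\<^esub>)\<rparr>"


section \<open>Shuffles and the cochain groups\<close>

text \<open>A tuple \<open>(h\<^sub>1, \<dots>, h\<^sub>s)\<close> is a list of length \<open>s\<close>; its entry \<open>h\<^sub>i\<close> is the list element
  at position \<open>i - 1\<close>. Accordingly, \<open>(l, s - l)\<close>-shuffles permute \<open>{..<s}\<close>.\<close>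

definition tuples :: "nat \<Rightarrow> 'h::zero list set" where
  "tuples s = {hs. length hs = s \<and> 0 \<notin> set hs}"

definition shuffle_perms :: "nat \<Rightarrow> nat \<Rightarrow> (nat \<Rightarrow> nat) set" where
  "shuffle_perms l s =
     {\<sigma>. \<sigma> permutes {..<s} \<and> strict_mono_on {..<l} \<sigma> \<and> strict_mono_on {l..<s} \<sigma>}"

definition shuffle_sum :: "nat \<Rightarrow> 'h list \<Rightarrow> ('h list \<Rightarrow>\<^sub>0 int)" where
  "shuffle_sum l hs =
     (\<Sum>\<sigma>\<in>shuffle_perms l (length hs).
        frag_cmul (sign \<sigma>) (frag_of (map (\<lambda>i. hs ! inv_into UNIV \<sigma> i) [0..<length hs])))"

definition shuffle_subgroup :: "nat \<Rightarrow> ('h::zero list \<Rightarrow>\<^sub>0 int) set" where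
  "shuffle_subgroup s =
     generate (free_Abelian_group (tuples s))
       {shuffle_sum l hs | l hs. 1 \<le> l \<and> l < s \<and> hs \<in> tuples s}"

definition Mbar :: "nat \<Rightarrow> ('h::zero list \<Rightarrow>\<^sub>0 int) set monoid" where
  "Mbar s = free_Abelian_group (tuples s) Mod shuffle_subgroup s"

definition shuffle_class :: "'h::zero list \<Rightarrow> ('h list \<Rightarrow>\<^sub>0 int) set" where
  "shuffle_class hs =
     shuffle_subgroup (length hs) #>\<^bsub>free_Abelian_group (tuples (length hs))\<^esub> frag_of hs"

type_synonym 'h tensor_element = "(('h list \<Rightarrow>\<^sub>0 int) \<times> ('h list \<Rightarrow>\<^sub>0 int) set \<Rightarrow>\<^sub>0 int) set"

type_synonym ('h, 'i) cochain = "'h tensor_element \<Rightarrow> 'i"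

definition cochains :: "nat \<Rightarrow> nat \<Rightarrow> ('h::zero, 'i::ab_group_add) cochain monoid" where
  "cochains r s = hom_group (tensor_group (free_Abelian_group (tuples r)) (Mbar s)) additive_group"

text \<open>The value \<open>f(h\<^sub>1, \<dots>, h\<^sub>r, [h\<^sub>r\<^sub>+\<^sub>1, \<dots>, h\<^sub>r\<^sub>+\<^sub>s])\<close>, where \<open>hs = (h\<^sub>1, \<dots>, h\<^sub>r)\<close> and
  \<open>ks = (h\<^sub>r\<^sub>+\<^sub>1, \<dots>, h\<^sub>r\<^sub>+\<^sub>s)\<close>, with the convention that it is zero if an entry is zero.\<close>

definition cochain_val ::
  "('h::zero, 'i::ab_group_add) cochain \<Rightarrow> 'h list \<Rightarrow> 'h list \<Rightarrow> 'i" where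
  "cochain_val f hs ks =
     (if 0 \<in> set hs \<union> set ks then 0
      else f (pure_tensor (free_Abelian_group (tuples (length hs))) (Mbar (length ks))
                (frag_of hs) (shuffle_class ks)))"


section \<open>The coboundary maps\<close>

definition alternate :: "nat \<Rightarrow> 'i::ab_group_add \<Rightarrow> 'i" where \<comment> \<open>\<open>(-1)\<^sup>n y\<close>\<close>
  "alternate n y = (if even n then y else - y)"

text \<open>\<open>merge j (h\<^sub>1, h\<^sub>2, \<dots>) = (h\<^sub>1, \<dots>, h\<^sub>j\<^sub>-\<^sub>1, h\<^sub>j + h\<^sub>j\<^sub>+\<^sub>1, h\<^sub>j\<^sub>+\<^sub>2, \<dots>)\<close> for \<open>j \<ge> 1\<close>.\<close>

definition merge :: "nat \<Rightarrow> 'h::ab_group_add list \<Rightarrow> 'h list" where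
  "merge j hs = take (j - 1) hs @ (hs ! (j - 1) + hs ! j) # drop (j + 1) hs"

definition R1 :: "('h::ab_group_add \<Rightarrow> 'h \<Rightarrow> 'h) \<Rightarrow> nat \<Rightarrow> 'h list \<Rightarrow> 'h" where
  "R1 dot r hs = dot (sum_list (take r hs)) (hs ! r)"

definition dh_formula ::
  "('h::ab_group_add \<Rightarrow> 'h \<Rightarrow> 'h) \<Rightarrow> ('h \<Rightarrow> 'i::ab_group_add \<Rightarrow> 'i) \<Rightarrow> nat \<Rightarrow>
   ('h, 'i) cochain \<Rightarrow> 'h list \<Rightarrow> 'h list \<Rightarrow> 'i" where
  "dh_formula dot act r f hs ks =
     cochain_val f (map (dot (hd hs)) (tl hs)) (map (dot (hd hs)) ks)
     + (\<Sum>j = 1..r. alternate j (cochain_val f (merge j hs) ks))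
     + alternate (r + 1) (act (R1 dot r hs) (cochain_val f (take r hs) ks))"

definition dv_formula ::
  "nat \<Rightarrow> nat \<Rightarrow> ('h::ab_group_add, 'i::ab_group_add) cochain \<Rightarrow> 'h list \<Rightarrow> 'h list \<Rightarrow> 'i" where
  "dv_formula r s f hs ks =
     alternate r (cochain_val f hs (tl ks))
     + (\<Sum>j = r + 1..r + s. alternate j (cochain_val f hs (merge (j - r) ks)))
     + alternate (r + s + 1) (cochain_val f hs (take s ks))"

text \<open>The coboundary maps are indexed by the bidegree \<open>(r, s)\<close> of their source, so that
  \<open>dh dot act r s\<close> is \<open>\<partial>\<^sub>h\<close> with upper index \<open>(r + 1, s)\<close> and \<open>dv r s\<close> is \<open>\<partial>\<^sub>v\<close> with upper index
  \<open>(r, s + 1)\<close>. A homomorphism on the tensor product is determined by its values on the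
  generators, which makes the cochains described here unique; their
  existence (the formulas respect shuffles) is not built into the definitions.\<close>

definition dh ::
  "('h::ab_group_add \<Rightarrow> 'h \<Rightarrow> 'h) \<Rightarrow> ('h \<Rightarrow> 'i::ab_group_add \<Rightarrow> 'i) \<Rightarrow> nat \<Rightarrow> nat \<Rightarrow>
   ('h, 'i) cochain \<Rightarrow> ('h, 'i) cochain" where
  "dh dot act r s f =
     (THE g. g \<in> carrier (cochains (r + 1) s) \<and>
        (\<forall>hs\<in>tuples (r + 1). \<forall>ks\<in>tuples s. cochain_val g hs ks = dh_formula dot act r f hs ks))"

definition dv ::
  "nat \<Rightarrow> nat \<Rightarrow> ('h::ab_group_add, 'i::ab_group_add) cochain \<Rightarrow> ('h, 'i) cochain" where
  "dv r s f =
     (THE g. g \<in> carrier (cochains r (s + 1)) \<and>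
        (\<forall>hs\<in>tuples r. \<forall>ks\<in>tuples (s + 1). cochain_val g hs ks = dv_formula r s f hs ks))"

end

theory Submission
  imports Defs
begin

text \<open>
  By the universal properties of the tensor product and of the quotient, a cochain is the same thing
  as a function of \<open>(hs, ks)\<close> that vanishes on shuffles in \<open>ks\<close>. In terms of face operators both
  coboundaries are alternating sums over a presimplicial object, so that the squares vanish by the
  usual cancellation in pairs. For the horizontal one, the only presimplicial identity that needs the
  module axiom is that of the two last faces, where \<open>u (u \<cdot> v) = u + v\<close> with \<open>u = S \<cdot> a\<close> and
  \<open>v = S \<cdot> b\<close>. When an entry is \<open>0\<close>, two adjacent faces cancel and the others vanish, so the defining
  formulas respect the normalization convention.

  The vertical coboundary respects shuffles because, after replacing \<open>x + y\<close> by the commutative product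
  \<open>[x + y] - [x] - [y]\<close> of \<open>[x]\<close> and \<open>[y]\<close>, it is the differential of a bar complex, which is a
  derivation for the shuffle product: merging a letter of the first factor with an adjacent
  letter of the second occurs twice with opposite signs.
\<close>

section \<open>Homomorphisms on quotients and tensor products\<close>

lemma additive_group_simps [simp]:
  "carrier (additive_group :: 'i::ab_group_add monoid) = UNIV"
  "x \<otimes>\<^bsub>additive_group\<^esub> y = x + (y :: 'i)"
  "\<one>\<^bsub>additive_group\<^esub> = (0 :: 'i)"
  by (simp_all add: additive_group_def)

lemma comm_group_additive_group: "comm_group (additive_group :: 'i::ab_group_add monoid)"
  by (rule comm_groupI) (auto simp: add_ac intro: exI[of _ "- x" for x :: 'i])

lemma group_additive_group: "group (additive_group :: 'i::ab_group_add monoid)"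
  using comm_group_additive_group comm_group_def by blast

lemma group_hom_additive:
  "group G \<Longrightarrow> h \<in> hom G additive_group \<Longrightarrow> group_hom G (additive_group :: 'i::ab_group_add monoid) h"
  by (simp add: group_hom_def group_hom_axioms_def group_additive_group)

section \<open>Homomorphisms out of free abelian groups and their quotients\<close>

context
  fixes h :: "('a \<Rightarrow>\<^sub>0 int) \<Rightarrow> 'i::ab_group_add" and S
  assumes h: "h \<in> hom (free_Abelian_group S) additive_group"
begin

lemma hom_free_Abelian_zero: "h 0 = 0"
  using hom_one[OF h] group_additive_group by force

lemma hom_free_Abelian_add: "Poly_Mapping.keys x \<subseteq> S \<Longrightarrow> Poly_Mapping.keys y \<subseteq> S \<Longrightarrow> h (x + y) = h x + h y"
  using hom_mult[OF h] by simp

lemma hom_free_Abelian_uminus: "Poly_Mapping.keys x \<subseteq> S \<Longrightarrow> h (- x) = - h x"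
  using hom_free_Abelian_add[of x "- x"] hom_free_Abelian_zero
  by (metis add.right_inverse keys_minus minus_unique)

lemma hom_free_Abelian_diff: "Poly_Mapping.keys x \<subseteq> S \<Longrightarrow> Poly_Mapping.keys y \<subseteq> S \<Longrightarrow> h (x - y) = h x - h y"
  using hom_free_Abelian_add[of x "- y"] hom_free_Abelian_uminus[of y] by simp

lemma hom_free_Abelian_sum:
  "(\<And>i. i \<in> I \<Longrightarrow> Poly_Mapping.keys (x i) \<subseteq> S) \<Longrightarrow> h (\<Sum>i\<in>I. x i) = (\<Sum>i\<in>I. h (x i))"
proof (induction I rule: infinite_finite_induct)
  case (insert i I)
  have "Poly_Mapping.keys (\<Sum>i\<in>I. x i) \<subseteq> S"
    using sum_closed_free_Abelian_group[of I x S] insert.prems by simp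
  with insert show ?case by (simp add: hom_free_Abelian_add)
qed (simp_all add: hom_free_Abelian_zero)

end

lemma hom_free_Abelian_eqI:
  fixes h h' :: "('a \<Rightarrow>\<^sub>0 int) \<Rightarrow> 'i::ab_group_add"
  assumes h: "h \<in> hom (free_Abelian_group S) additive_group"
    and h': "h' \<in> hom (free_Abelian_group S) additive_group"
    and eq: "\<And>a. a \<in> S \<Longrightarrow> h (frag_of a) = h' (frag_of a)"
    and x: "Poly_Mapping.keys x \<subseteq> S"
  shows "h x = h' x"
  by (rule free_Abelian_group_induct[where P = "\<lambda>x. h x = h' x", OF x])
    (use eq in \<open>simp_all add: hom_free_Abelian_zero[OF h] hom_free_Abelian_zero[OF h']
      hom_free_Abelian_diff[OF h] hom_free_Abelian_diff[OF h']\<close>)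

lemma generate_normal_free_Abelian_group:
  assumes "R \<subseteq> carrier (free_Abelian_group S)"
  shows "generate (free_Abelian_group S) R \<lhd> free_Abelian_group S"
proof -
  interpret comm_group "free_Abelian_group S" by (rule abelian_free_Abelian_group)
  show ?thesis
    using assms generate_is_subgroup normal_iff_subgroup by blast
qed

text \<open>The kernel of \<open>h\<close> is a subgroup containing \<open>R\<close>, hence contains
  the subgroup generated by \<open>R\<close>, and \<open>h\<close> factors through the
  quotient.\<close>

lemma hom_quotient_lift:
  fixes h :: "('a \<Rightarrow>\<^sub>0 int) \<Rightarrow> 'i::ab_group_add"
  assumes h: "h \<in> hom (free_Abelian_group S) additive_group"
    and R: "R \<subseteq> carrier (free_Abelian_group S)"
    and 0: "\<And>x. x \<in> R \<Longrightarrow> h x = 0"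
  obtains g where "g \<in> hom (free_Abelian_group S Mod generate (free_Abelian_group S) R) additive_group"
    "\<And>x. Poly_Mapping.keys x \<subseteq> S \<Longrightarrow> g (generate (free_Abelian_group S) R #>\<^bsub>free_Abelian_group S\<^esub> x) = h x"
proof -
  interpret H: group_hom "free_Abelian_group S" additive_group h
    by (rule group_hom_additive) (auto intro: h)
  have "R \<subseteq> kernel (free_Abelian_group S) additive_group h"
    using R 0 by (force simp: kernel_def)
  then have "generate (free_Abelian_group S) R \<subseteq> kernel (free_Abelian_group S) additive_group h"
    by (rule group.generate_subgroup_incl[OF group_free_Abelian_group _ H.subgroup_kernel])
  then show thesis
    using H.FactGroup_universal_kernel[OF generate_normal_free_Abelian_group[OF R]] that
    by (metis carrier_free_Abelian_group_iff)
qed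

text \<open>Pulling both maps back along the projection reduces the comparison to the basis of the
  free abelian group.\<close>

lemma quotient_hom_eqI:
  fixes g g' :: "('a \<Rightarrow>\<^sub>0 int) set \<Rightarrow> 'i::ab_group_add"
  assumes N: "N \<lhd> free_Abelian_group S"
    and g: "g \<in> hom (free_Abelian_group S Mod N) additive_group"
    and g': "g' \<in> hom (free_Abelian_group S Mod N) additive_group"
    and eq: "\<And>a. a \<in> S \<Longrightarrow> g (N #>\<^bsub>free_Abelian_group S\<^esub> frag_of a) = g' (N #>\<^bsub>free_Abelian_group S\<^esub> frag_of a)"
    and x: "x \<in> carrier (free_Abelian_group S Mod N)"
  shows "g x = g' x"
proof -
  let ?p = "\<lambda>a. N #>\<^bsub>free_Abelian_group S\<^esub> a"
  obtain a where a: "Poly_Mapping.keys a \<subseteq> S" "x = ?p a"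
    using x by (auto simp: carrier_FactGroup)
  have p: "?p \<in> hom (free_Abelian_group S) (free_Abelian_group S Mod N)"
    by (rule normal.r_coset_hom_Mod[OF N])
  have "(g \<circ> ?p) a = (g' \<circ> ?p) a"
    by (rule hom_free_Abelian_eqI[OF hom_compose[OF p g] hom_compose[OF p g'] _ a(1)])
      (simp add: eq)
  then show ?thesis by (simp add: a)
qed

section \<open>Bilinearity and the universal property of the tensor product\<close>

context
  fixes G :: "('a, 'm) monoid_scheme" and K :: "('b, 'n) monoid_scheme"
  assumes G: "group G" and K: "group K"
begin

lemma tensor_relations_subset:
  "tensor_relations G K \<subseteq> carrier (free_Abelian_group (carrier G \<times> carrier K))"
proof -
  interpret G: group G by (rule G)
  interpret K: group K by (rule K)
  have *: "Poly_Mapping.keys (frag_of a - frag_of b - frag_of c) \<subseteq> T"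
    if "a \<in> T" "b \<in> T" "c \<in> T" for a b c :: "'a \<times> 'b" and T
    using keys_diff[of "frag_of a - frag_of b" "frag_of c"] keys_diff[of "frag_of a" "frag_of b"] that
    by fastforce
  show ?thesis
    unfolding tensor_relations_def
    by (intro Un_least subsetI) (clarify, simp only: carrier_free_Abelian_group_iff, rule *, simp, simp, simp)+
qed

lemma tensor_kernel_normal:
  "tensor_kernel G K \<lhd> free_Abelian_group (carrier G \<times> carrier K)"
  unfolding tensor_kernel_def
  by (rule generate_normal_free_Abelian_group[OF tensor_relations_subset])

lemma group_tensor_group: "group (tensor_group G K)"
  unfolding tensor_group_def by (rule normal.factorgroup_is_group[OF tensor_kernel_normal])

lemma pure_tensor_carrier:
  "x \<in> carrier G \<Longrightarrow> y \<in> carrier K \<Longrightarrow> pure_tensor G K x y \<in> carrier (tensor_group G K)"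
  by (auto simp: pure_tensor_def tensor_group_def carrier_FactGroup)

lemma tensor_kernel_coset_eq:
  assumes "Poly_Mapping.keys a \<subseteq> carrier G \<times> carrier K" "Poly_Mapping.keys b \<subseteq> carrier G \<times> carrier K"
    and "a - b \<in> tensor_kernel G K"
  shows "tensor_kernel G K #>\<^bsub>free_Abelian_group (carrier G \<times> carrier K)\<^esub> a
       = tensor_kernel G K #>\<^bsub>free_Abelian_group (carrier G \<times> carrier K)\<^esub> b"
proof -
  let ?F = "free_Abelian_group (carrier G \<times> carrier K)"
  interpret N: normal "tensor_kernel G K" ?F by (rule tensor_kernel_normal)
  have "a \<otimes>\<^bsub>?F\<^esub> inv\<^bsub>?F\<^esub> b \<in> tensor_kernel G K"
    using assms by simp
  then have "tensor_kernel G K #>\<^bsub>?F\<^esub> (a \<otimes>\<^bsub>?F\<^esub> inv\<^bsub>?F\<^esub> b) = tensor_kernel G K"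
    using N.subgroup_axioms N.subset by (intro N.coset_join2) blast+
  then show ?thesis
    using assms N.subset by (intro N.coset_mult_inv1) auto
qed

text \<open>Each half of \<open>tensor_relations\<close> is additivity in one variable, so the
  relevant differences lie in \<open>tensor_kernel\<close> and the cosets coincide.\<close>

lemma pure_tensor_mult:
  assumes "x \<in> carrier G" "x' \<in> carrier G" "y \<in> carrier K" "y' \<in> carrier K"
  shows "pure_tensor G K (x \<otimes>\<^bsub>G\<^esub> x') y = pure_tensor G K x y \<otimes>\<^bsub>tensor_group G K\<^esub> pure_tensor G K x' y"
    and "pure_tensor G K x (y \<otimes>\<^bsub>K\<^esub> y') = pure_tensor G K x y \<otimes>\<^bsub>tensor_group G K\<^esub> pure_tensor G K x y'"
proof -
  let ?F = "free_Abelian_group (carrier G \<times> carrier K)"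
  interpret G: group G by (rule G)
  interpret K: group K by (rule K)
  interpret N: normal "tensor_kernel G K" ?F by (rule tensor_kernel_normal)
  have *: "pure_tensor G K a b \<otimes>\<^bsub>tensor_group G K\<^esub> pure_tensor G K c d
     = tensor_kernel G K #>\<^bsub>?F\<^esub> (frag_of (a, b) + frag_of (c, d))"
    if "a \<in> carrier G" "c \<in> carrier G" "b \<in> carrier K" "d \<in> carrier K" for a b c d
    using that N.rcos_sum[of "frag_of (a, b)" "frag_of (c, d)"]
    by (simp add: pure_tensor_def tensor_group_def)
  have k: "Poly_Mapping.keys (frag_of p + frag_of q) \<subseteq> carrier G \<times> carrier K"
    if "p \<in> carrier G \<times> carrier K" "q \<in> carrier G \<times> carrier K" for p q :: "'a \<times> 'b"
    using keys_add[of "frag_of p" "frag_of q"] that by auto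
  have "frag_of (x \<otimes>\<^bsub>G\<^esub> x', y) - (frag_of (x, y) + frag_of (x', y)) \<in> tensor_kernel G K"
    unfolding tensor_kernel_def diff_diff_eq[symmetric]
    by (rule generate.incl) (use assms in \<open>auto simp: tensor_relations_def\<close>)
  then show "pure_tensor G K (x \<otimes>\<^bsub>G\<^esub> x') y = pure_tensor G K x y \<otimes>\<^bsub>tensor_group G K\<^esub> pure_tensor G K x' y"
    using assms by (subst *) (simp_all only: pure_tensor_def, rule tensor_kernel_coset_eq, simp, rule k, simp_all)
  have "frag_of (x, y \<otimes>\<^bsub>K\<^esub> y') - (frag_of (x, y) + frag_of (x, y')) \<in> tensor_kernel G K"
    unfolding tensor_kernel_def diff_diff_eq[symmetric]
    by (rule generate.incl) (use assms in \<open>auto simp: tensor_relations_def\<close>)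
  then show "pure_tensor G K x (y \<otimes>\<^bsub>K\<^esub> y') = pure_tensor G K x y \<otimes>\<^bsub>tensor_group G K\<^esub> pure_tensor G K x y'"
    using assms by (subst *) (simp_all only: pure_tensor_def, rule tensor_kernel_coset_eq, simp, rule k, simp_all)
qed

lemma pure_tensor_homs:
  fixes f :: "_ \<Rightarrow> 'i::ab_group_add"
  assumes f: "f \<in> hom (tensor_group G K) additive_group"
  shows "y \<in> carrier K \<Longrightarrow> (\<lambda>x. f (pure_tensor G K x y)) \<in> hom G additive_group"
    and "x \<in> carrier G \<Longrightarrow> (\<lambda>y. f (pure_tensor G K x y)) \<in> hom K additive_group"
  using hom_mult[OF f] by (auto simp: hom_def pure_tensor_mult pure_tensor_carrier)

lemma tensor_hom_eqI:
  fixes f f' :: "_ \<Rightarrow> 'i::ab_group_add"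
  assumes f: "f \<in> hom (tensor_group G K) additive_group"
    and f': "f' \<in> hom (tensor_group G K) additive_group"
    and eq: "\<And>x y. x \<in> carrier G \<Longrightarrow> y \<in> carrier K \<Longrightarrow> f (pure_tensor G K x y) = f' (pure_tensor G K x y)"
    and t: "t \<in> carrier (tensor_group G K)"
  shows "f t = f' t"
  using f f' eq t unfolding tensor_group_def pure_tensor_def
  by (intro quotient_hom_eqI[OF tensor_kernel_normal, of f f' t]) auto

text \<open>The additive extension of \<open>case_prod \<beta>\<close> to the free abelian group
  kills both families of relations because \<beta> is additive in each variable.\<close>

lemma tensor_hom_exists:
  fixes \<beta> :: "'a \<Rightarrow> 'b \<Rightarrow> 'i::ab_group_add"
  assumes "\<And>y. y \<in> carrier K \<Longrightarrow> (\<lambda>x. \<beta> x y) \<in> hom G additive_group"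
    and "\<And>x. x \<in> carrier G \<Longrightarrow> \<beta> x \<in> hom K additive_group"
  obtains f where "f \<in> hom (tensor_group G K) additive_group"
    "\<And>x y. x \<in> carrier G \<Longrightarrow> y \<in> carrier K \<Longrightarrow> f (pure_tensor G K x y) = \<beta> x y"
proof -
  let ?S = "carrier G \<times> carrier K"
  interpret G: group G by (rule G)
  interpret K: group K by (rule K)
  obtain h :: "_ \<Rightarrow> 'i" where h: "h \<in> hom (free_Abelian_group ?S) additive_group"
    and hb: "\<And>z. z \<in> ?S \<Longrightarrow> h (frag_of z) = case_prod \<beta> z"
    by (rule comm_group.free_Abelian_group_universal[OF comm_group_additive_group,
          of "case_prod \<beta>" ?S]) auto
  have k: "Poly_Mapping.keys (frag_of p - frag_of q) \<subseteq> ?S" if "p \<in> ?S" "q \<in> ?S" for p q :: "'a \<times> 'b"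
    using keys_diff[of "frag_of p" "frag_of q"] that by auto
  have d: "h (frag_of p - frag_of q - frag_of r) = case_prod \<beta> p - case_prod \<beta> q - case_prod \<beta> r"
    if "p \<in> ?S" "q \<in> ?S" "r \<in> ?S" for p q r
    using that k[of p q] by (subst hom_free_Abelian_diff[OF h]; (subst hom_free_Abelian_diff[OF h])?) (simp_all add: hb)
  have "h z = 0" if "z \<in> tensor_relations G K" for z
    using that hom_mult[OF assms(1)] hom_mult[OF assms(2)]
    by (auto simp: tensor_relations_def d)
  from hom_quotient_lift[OF h tensor_relations_subset this]
  obtain f where "f \<in> hom (tensor_group G K) additive_group"
    "\<And>z. Poly_Mapping.keys z \<subseteq> ?S \<Longrightarrow> f (tensor_kernel G K #>\<^bsub>free_Abelian_group ?S\<^esub> z) = h z"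
    unfolding tensor_group_def tensor_kernel_def by blast
  with that hb show thesis
    by (simp add: pure_tensor_def)
qed

end

lemma comm_group_hom_group_additive:
  assumes "group G"
  shows "comm_group (hom_group G (additive_group :: 'i::ab_group_add monoid))"
proof -
  interpret group G by (rule assms)
  show ?thesis
  proof (rule comm_groupI)
    fix f assume "f \<in> carrier (hom_group G (additive_group :: 'i monoid))"
    then show "\<exists>g\<in>carrier (hom_group G additive_group).
       g \<otimes>\<^bsub>hom_group G additive_group\<^esub> f = \<one>\<^bsub>hom_group G additive_group\<^esub>"
      by (intro bexI[of _ "\<lambda>x\<in>carrier G. - f x"])
        (auto simp: hom_group_def hom_def fun_eq_iff restrict_def extensional_def)
  qed (auto simp: hom_group_def hom_def fun_eq_iff restrict_def extensional_def add_ac)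
qed

section \<open>Cochains as functions of tuples\<close>

text \<open>The value that the additive extension of \<open>g\<close> takes on
  \<open>shuffle_sum l hs\<close>. The sign is expressed by \<open>alternate\<close>, since the
  target is only an abelian group.\<close>

definition shuffle_eval :: "nat \<Rightarrow> ('h list \<Rightarrow> 'i::ab_group_add) \<Rightarrow> 'h list \<Rightarrow> 'i" where
  "shuffle_eval l g hs =
     (\<Sum>\<sigma>\<in>shuffle_perms l (length hs).
        alternate (if evenperm \<sigma> then 0 else 1) (g (map (\<lambda>i. hs ! inv_into UNIV \<sigma> i) [0..<length hs])))"

lemma set_map_permutes:
  assumes "\<sigma> permutes {..<length hs}"
  shows "set (map (\<lambda>i. hs ! inv_into UNIV \<sigma> i) [0..<length hs]) = set hs"
proof -
  have "inv_into UNIV \<sigma> ` {0..<length hs} = {0..<length hs}"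
    using permutes_image[OF permutes_inv[OF assms]] by (simp add: atLeast0LessThan)
  then have "(\<lambda>i. hs ! inv_into UNIV \<sigma> i) ` {0..<length hs} = (!) hs ` {0..<length hs}"
    by (metis image_image)
  then show ?thesis
    by (simp add: nth_image)
qed

lemma shuffle_perms_permutes: "\<sigma> \<in> shuffle_perms l s \<Longrightarrow> \<sigma> permutes {..<s}"
  by (simp add: shuffle_perms_def)

lemma map_shuffle_tuples:
  assumes "hs \<in> tuples s" "\<sigma> \<in> shuffle_perms l (length hs)"
  shows "map (\<lambda>i. hs ! inv_into UNIV \<sigma> i) [0..<length hs] \<in> tuples s"
  using assms(1) set_map_permutes[OF shuffle_perms_permutes[OF assms(2)]] by (simp add: tuples_def)

lemma keys_shuffle_sum:
  assumes "hs \<in> tuples s"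
  shows "Poly_Mapping.keys (shuffle_sum l hs) \<subseteq> tuples s"
proof -
  have "shuffle_sum l hs \<in> carrier (free_Abelian_group (tuples s))"
    unfolding shuffle_sum_def
    using map_shuffle_tuples[OF assms] by (intro sum_closed_free_Abelian_group) (simp add: sign_def)
  then show ?thesis by simp
qed

lemma shuffle_sum_subset:
  "{shuffle_sum l hs | l hs. 1 \<le> l \<and> l < s \<and> hs \<in> tuples s} \<subseteq> carrier (free_Abelian_group (tuples s))"
  using keys_shuffle_sum by fastforce

lemma shuffle_subgroup_normal: "shuffle_subgroup s \<lhd> free_Abelian_group (tuples s)"
  unfolding shuffle_subgroup_def by (rule generate_normal_free_Abelian_group[OF shuffle_sum_subset])

lemma group_Mbar: "group (Mbar s)"
  unfolding Mbar_def by (rule normal.factorgroup_is_group[OF shuffle_subgroup_normal])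

lemma shuffle_class_carrier: "hs \<in> tuples s \<Longrightarrow> shuffle_class hs \<in> carrier (Mbar s)"
  by (auto simp: tuples_def shuffle_class_def Mbar_def carrier_FactGroup)

lemma hom_shuffle_sum:
  fixes h :: "_ \<Rightarrow> 'i::ab_group_add"
  assumes h: "h \<in> hom (free_Abelian_group (tuples s)) additive_group" and hs: "hs \<in> tuples s"
  shows "h (shuffle_sum l hs) = shuffle_eval l (\<lambda>ks. h (frag_of ks)) hs"
  unfolding shuffle_sum_def shuffle_eval_def
proof (subst hom_free_Abelian_sum[OF h])
  fix \<sigma> assume \<sigma>: "\<sigma> \<in> shuffle_perms l (length hs)"
  then show "Poly_Mapping.keys (frag_cmul (sign \<sigma>)
      (frag_of (map (\<lambda>i. hs ! inv_into UNIV \<sigma> i) [0..<length hs]))) \<subseteq> tuples s"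
    using map_shuffle_tuples[OF hs \<sigma>] by (simp add: sign_def)
qed (auto intro!: sum.cong simp: alternate_def sign_def
      hom_free_Abelian_uminus[OF h] map_shuffle_tuples[OF hs])

text \<open>The hypothesis says that the additive extension of \<open>g\<close> to the free abelian
  group kills the generators of \<open>shuffle_subgroup s\<close>.\<close>

lemma Mbar_hom_exists:
  fixes g :: "'h::zero list \<Rightarrow> 'i::ab_group_add"
  assumes "\<And>l ks. 1 \<le> l \<Longrightarrow> l < s \<Longrightarrow> ks \<in> tuples s \<Longrightarrow> shuffle_eval l g ks = 0"
  obtains h where "h \<in> hom (Mbar s) additive_group"
    "\<And>ks. ks \<in> tuples s \<Longrightarrow> h (shuffle_class ks) = g ks"
proof -
  obtain h :: "_ \<Rightarrow> 'i" where h: "h \<in> hom (free_Abelian_group (tuples s)) additive_group"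
    and hg: "\<And>ks. ks \<in> tuples s \<Longrightarrow> h (frag_of ks) = g ks"
    by (rule comm_group.free_Abelian_group_universal[OF comm_group_additive_group, of g "tuples s"]) auto
  have "h x = 0" if "x \<in> {shuffle_sum l hs | l hs. 1 \<le> l \<and> l < s \<and> hs \<in> tuples s}" for x
  proof -
    from that obtain l hs where x: "x = shuffle_sum l hs" and l: "1 \<le> l" "l < s" and hs: "hs \<in> tuples s"
      by blast
    have "h x = shuffle_eval l g hs"
      unfolding x hom_shuffle_sum[OF h hs] unfolding shuffle_eval_def
      using map_shuffle_tuples[OF hs] by (intro sum.cong) (simp_all add: hg)
    with assms l hs show ?thesis by simp
  qed
  from hom_quotient_lift[OF h shuffle_sum_subset this]
  obtain h' where "h' \<in> hom (Mbar s) additive_group"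
    "\<And>x. Poly_Mapping.keys x \<subseteq> tuples s \<Longrightarrow>
       h' (shuffle_subgroup s #>\<^bsub>free_Abelian_group (tuples s)\<^esub> x) = h x"
    unfolding Mbar_def shuffle_subgroup_def by blast
  with that hg show thesis
    by (simp add: shuffle_class_def tuples_def)
qed

lemma Mbar_hom_eqI:
  fixes h h' :: "_ \<Rightarrow> 'i::ab_group_add"
  assumes "h \<in> hom (Mbar s) additive_group" "h' \<in> hom (Mbar s) additive_group"
    and "\<And>ks. ks \<in> tuples s \<Longrightarrow> h (shuffle_class ks) = h' (shuffle_class ks)"
    and "m \<in> carrier (Mbar s)"
  shows "h m = h' m"
  using assms unfolding Mbar_def
  by (intro quotient_hom_eqI[OF shuffle_subgroup_normal, of h s h' m])
    (auto simp: shuffle_class_def tuples_def)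

text \<open>Converse of \<open>Mbar_hom_exists\<close>: \<open>shuffle_sum l ks\<close> lies in the
  subgroup divided out, so its class is neutral.\<close>

lemma shuffle_class_hom_shuffle_eval:
  fixes h :: "('h::zero list \<Rightarrow>\<^sub>0 int) set \<Rightarrow> 'i::ab_group_add"
  assumes h: "h \<in> hom (Mbar s) additive_group" and l: "1 \<le> l" "l < s" and ks: "ks \<in> tuples s"
  shows "shuffle_eval l (\<lambda>ks. h (shuffle_class ks)) ks = 0"
proof -
  let ?F = "free_Abelian_group (tuples s) :: ('h list \<Rightarrow>\<^sub>0 int) monoid"
  let ?p = "\<lambda>x. shuffle_subgroup s #>\<^bsub>?F\<^esub> x"
  interpret N: normal "shuffle_subgroup s" ?F by (rule shuffle_subgroup_normal)
  have hp: "h \<circ> ?p \<in> hom ?F additive_group"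
    using hom_compose[OF N.r_coset_hom_Mod] h unfolding Mbar_def by blast
  have "shuffle_sum l ks \<in> shuffle_subgroup s"
    unfolding shuffle_subgroup_def using l ks by (intro generate.incl) auto
  then have "?p (shuffle_sum l ks) = shuffle_subgroup s"
    using keys_shuffle_sum[OF ks] N.subgroup_axioms by (intro N.coset_join2) auto
  moreover have "h (shuffle_subgroup s) = 0"
    using hom_one[OF h group_Mbar group_additive_group] by (simp add: Mbar_def)
  ultimately have "(h \<circ> ?p) (shuffle_sum l ks) = 0" by simp
  then have "shuffle_eval l (\<lambda>ks. (h \<circ> ?p) (frag_of ks)) ks = 0"
    by (simp only: hom_shuffle_sum[OF hp ks])
  moreover have "length ks = s" using ks by (simp add: tuples_def)
  ultimately show ?thesis
    by (simp add: shuffle_eval_def shuffle_class_def)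
qed

section \<open>Cochains and their values on tuples\<close>

lemma cochains_simps:
  "carrier (cochains r s :: ('h::zero, 'i::ab_group_add) cochain monoid)
    = hom (tensor_group (free_Abelian_group (tuples r)) (Mbar s)) additive_group
      \<inter> extensional (carrier (tensor_group (free_Abelian_group (tuples r)) (Mbar s)))"
  "f \<otimes>\<^bsub>cochains r s :: ('h, 'i) cochain monoid\<^esub> g
    = (\<lambda>x\<in>carrier (tensor_group (free_Abelian_group (tuples r)) (Mbar s)). f x + g x)"
  by (simp_all add: cochains_def hom_group_def)

lemma comm_group_cochains: "comm_group (cochains r s)"
  unfolding cochains_def
  by (intro comm_group_hom_group_additive group_tensor_group group_Mbar) simp

lemma cochain_val_tuples:
  "hs \<in> tuples r \<Longrightarrow> ks \<in> tuples s \<Longrightarrow>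
    cochain_val f hs ks = f (pure_tensor (free_Abelian_group (tuples r)) (Mbar s) (frag_of hs) (shuffle_class ks))"
  by (auto simp: cochain_val_def tuples_def)

lemma cochain_val_zero: "0 \<in> set hs \<union> set ks \<Longrightarrow> cochain_val f hs ks = 0"
  by (auto simp: cochain_val_def)

text \<open>Extensionality leaves only the carrier to compare. Agreement spreads from the generators
  to all of \<open>Mbar s\<close> in the second factor, then to the free abelian group in the first,
  and so to all pure tensors.\<close>

lemma cochain_eqI:
  fixes f f' :: "('h::zero, 'i::ab_group_add) cochain"
  assumes f: "f \<in> carrier (cochains r s)" and f': "f' \<in> carrier (cochains r s)"
    and eq: "\<And>hs ks. hs \<in> tuples r \<Longrightarrow> ks \<in> tuples s \<Longrightarrow> cochain_val f hs ks = cochain_val f' hs ks"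
  shows "f = f'"
proof (rule extensionalityI)
  let ?G = "free_Abelian_group (tuples r) :: ('h list \<Rightarrow>\<^sub>0 int) monoid" and ?K = "Mbar s :: ('h list \<Rightarrow>\<^sub>0 int) set monoid"
  show "f \<in> extensional (carrier (tensor_group ?G ?K))" "f' \<in> extensional (carrier (tensor_group ?G ?K))"
    using f f' by (simp_all add: cochains_simps)
  have h: "f \<in> hom (tensor_group ?G ?K) additive_group" "f' \<in> hom (tensor_group ?G ?K) additive_group"
    using f f' by (simp_all add: cochains_simps)
  have 1: "f (pure_tensor ?G ?K (frag_of hs) m) = f' (pure_tensor ?G ?K (frag_of hs) m)"
    if hs: "hs \<in> tuples r" and m: "m \<in> carrier ?K" for hs m
    by (rule Mbar_hom_eqI[where h = "\<lambda>m. f (pure_tensor ?G ?K (frag_of hs) m)"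
          and h' = "\<lambda>m. f' (pure_tensor ?G ?K (frag_of hs) m)", OF _ _ _ m])
      (use hs eq in \<open>auto intro!: pure_tensor_homs(2) h group_Mbar simp: cochain_val_tuples\<close>)
  have 2: "f (pure_tensor ?G ?K x m) = f' (pure_tensor ?G ?K x m)"
    if x: "x \<in> carrier ?G" and m: "m \<in> carrier ?K" for x m
    by (rule hom_free_Abelian_eqI[where h = "\<lambda>x. f (pure_tensor ?G ?K x m)"
          and h' = "\<lambda>x. f' (pure_tensor ?G ?K x m)" and S = "tuples r"])
      (use x m 1 in \<open>auto intro!: pure_tensor_homs(1) h group_Mbar\<close>)
  show "f t = f' t" if "t \<in> carrier (tensor_group ?G ?K)" for t
    by (rule tensor_hom_eqI[OF group_free_Abelian_group group_Mbar h 2 that])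
qed

text \<open>The bilinear map is built one variable at a time: \<open>\<psi> hs\<close> extends
  \<open>g hs\<close> to \<open>Mbar s\<close>, then \<open>\<theta> m\<close> extends
  \<open>\<psi> hs m\<close>, as a function of \<open>hs\<close>, to the free abelian group.\<close>

lemma cochain_exists:
  fixes g :: "'h::zero list \<Rightarrow> 'h list \<Rightarrow> 'i::ab_group_add"
  assumes "\<And>l hs ks. 1 \<le> l \<Longrightarrow> l < s \<Longrightarrow> hs \<in> tuples r \<Longrightarrow> ks \<in> tuples s \<Longrightarrow> shuffle_eval l (g hs) ks = 0"
  obtains f where "f \<in> carrier (cochains r s)"
    "\<And>hs ks. hs \<in> tuples r \<Longrightarrow> ks \<in> tuples s \<Longrightarrow> cochain_val f hs ks = g hs ks"
proof -
  let ?G = "free_Abelian_group (tuples r) :: ('h list \<Rightarrow>\<^sub>0 int) monoid" and ?K = "Mbar s :: ('h list \<Rightarrow>\<^sub>0 int) set monoid"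
  let ?T = "tensor_group ?G ?K"
  have "\<exists>h. h \<in> hom ?K additive_group \<and> (\<forall>ks\<in>tuples s. h (shuffle_class ks) = g hs ks)"
    if "hs \<in> tuples r" for hs
    using Mbar_hom_exists[of s "g hs"] assms that by metis
  then obtain \<psi> where \<psi>: "\<And>hs. hs \<in> tuples r \<Longrightarrow> \<psi> hs \<in> hom ?K additive_group"
    and \<psi>g: "\<And>hs ks. hs \<in> tuples r \<Longrightarrow> ks \<in> tuples s \<Longrightarrow> \<psi> hs (shuffle_class ks) = g hs ks"
    by metis
  have "\<exists>h. h \<in> hom ?G additive_group \<and> (\<forall>hs\<in>tuples r. h (frag_of hs) = \<psi> hs m)" for m
    using comm_group.free_Abelian_group_universal[OF comm_group_additive_group, of "\<lambda>hs. \<psi> hs m" "tuples r"]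
    by (metis UNIV_I additive_group_simps(1) subsetI)
  then obtain \<theta> where \<theta>: "\<And>m. \<theta> m \<in> hom ?G additive_group"
    and \<theta>\<psi>: "\<And>hs m. hs \<in> tuples r \<Longrightarrow> \<theta> m (frag_of hs) = \<psi> hs m"
    by metis
  \<comment> \<open>Additivity in \<open>m\<close> comes from \<open>\<psi> hs\<close>, that is, at
    basis elements; both sides are homomorphisms in \<open>x\<close>, so it carries over to all
    \<open>x\<close>.\<close>
  have add: "\<theta> (m \<otimes>\<^bsub>?K\<^esub> m') x = \<theta> m x + \<theta> m' x"
    if "x \<in> carrier ?G" "m \<in> carrier ?K" "m' \<in> carrier ?K" for x m m'
  proof (rule hom_free_Abelian_eqI[where S = "tuples r", OF \<theta>])
    show "(\<lambda>x. \<theta> m x + \<theta> m' x) \<in> hom ?G additive_group"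
      using hom_mult[OF \<theta>] by (auto simp: hom_def add_ac)
  qed (use that \<psi> hom_mult[OF \<psi>] in \<open>auto simp: \<theta>\<psi>\<close>)
  obtain f where f: "f \<in> hom ?T additive_group"
    and f\<theta>: "\<And>x m. x \<in> carrier ?G \<Longrightarrow> m \<in> carrier ?K \<Longrightarrow> f (pure_tensor ?G ?K x m) = \<theta> m x"
    by (rule tensor_hom_exists[of ?G ?K "\<lambda>x m. \<theta> m x"])
      (use \<theta> add in \<open>auto simp: group_Mbar hom_def\<close>)
  show thesis
  \<comment> \<open>The restriction makes the homomorphism extensional, as membership in
    \<open>cochains r s\<close> demands.\<close>
  proof (rule that[of "restrict f (carrier ?T)"])
    interpret T: group ?T by (intro group_tensor_group group_Mbar) simp
    show "restrict f (carrier ?T) \<in> carrier (cochains r s)"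
      using f by (auto simp: cochains_simps hom_def)
    show "cochain_val (restrict f (carrier ?T)) hs ks = g hs ks" if "hs \<in> tuples r" "ks \<in> tuples s" for hs ks
      using that shuffle_class_carrier[OF that(2)]
      by (simp add: cochain_val_tuples pure_tensor_carrier group_Mbar f\<theta> \<theta>\<psi> \<psi>g)
  qed
qed

lemma cochain_val_mult:
  fixes f f' :: "('h::zero, 'i::ab_group_add) cochain"
  assumes "length hs = r" "length ks = s"
  shows "cochain_val (f \<otimes>\<^bsub>cochains r s\<^esub> f') hs ks = cochain_val f hs ks + cochain_val f' hs ks"
proof (cases "0 \<in> set hs \<union> set ks")
  case False
  with assms have "hs \<in> tuples r" "ks \<in> tuples s" by (auto simp: tuples_def)
  then show ?thesis
    by (simp add: cochain_val_tuples cochains_simps pure_tensor_carrier group_Mbar shuffle_class_carrier)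
qed (simp add: cochain_val_zero)

lemma cochain_val_one:
  fixes hs :: "'h::zero list"
  assumes "hs \<in> tuples r" "ks \<in> tuples s"
  shows "cochain_val \<one>\<^bsub>cochains r s :: ('h, 'i::ab_group_add) cochain monoid\<^esub> hs ks = 0"
  using assms
  by (simp add: cochain_val_tuples cochains_def hom_group_def pure_tensor_carrier group_Mbar shuffle_class_carrier)

text \<open>A zero entry survives every permutation, so then all summands are zero by convention;
  otherwise the value factors through \<open>Mbar s\<close>, where shuffles vanish.\<close>

lemma shuffle_eval_cochain_val:
  fixes f :: "('h::zero, 'i::ab_group_add) cochain"
  assumes f: "f \<in> carrier (cochains r s)" and "length hs = r" "length ks = s" and l: "1 \<le> l" "l < s"
  shows "shuffle_eval l (cochain_val f hs) ks = 0"
proof (cases "0 \<in> set hs \<union> set ks")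
  case True
  then have "cochain_val f hs (map (\<lambda>i. ks ! inv_into UNIV \<sigma> i) [0..<length ks]) = 0"
    if "\<sigma> \<in> shuffle_perms l (length ks)" for \<sigma>
    using set_map_permutes[OF shuffle_perms_permutes[OF that]] by (intro cochain_val_zero) auto
  then show ?thesis
    unfolding shuffle_eval_def by (intro sum.neutral) (simp add: alternate_def)
next
  case False
  let ?G = "free_Abelian_group (tuples r) :: ('h list \<Rightarrow>\<^sub>0 int) monoid" and ?K = "Mbar s :: ('h list \<Rightarrow>\<^sub>0 int) set monoid"
  from False assms have hs: "hs \<in> tuples r" and ks: "ks \<in> tuples s" by (auto simp: tuples_def)
  have "(\<lambda>m. f (pure_tensor ?G ?K (frag_of hs) m)) \<in> hom ?K additive_group"
    by (rule pure_tensor_homs(2)) (use f hs in \<open>auto simp: cochains_simps group_Mbar\<close>)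
  from shuffle_class_hom_shuffle_eval[OF this l ks] show ?thesis
    unfolding shuffle_eval_def
    by (simp add: cochain_val_tuples[OF hs map_shuffle_tuples[OF ks]] cong: sum.cong)
qed

text \<open>Existence comes from \<open>cochain_exists\<close>, uniqueness from
  \<open>cochain_eqI\<close>. Hence the definite descriptions in \<open>dh\<close> and
  \<open>dv\<close> are meaningful once the formulas are known to vanish on shuffles.\<close>

lemma cochain_the_spec:
  fixes g :: "'h::zero list \<Rightarrow> 'h list \<Rightarrow> 'i::ab_group_add"
  assumes "\<And>l hs ks. 1 \<le> l \<Longrightarrow> l < s \<Longrightarrow> hs \<in> tuples r \<Longrightarrow> ks \<in> tuples s \<Longrightarrow> shuffle_eval l (g hs) ks = 0"
  defines "P \<equiv> \<lambda>f. f \<in> carrier (cochains r s) \<and> (\<forall>hs\<in>tuples r. \<forall>ks\<in>tuples s. cochain_val f hs ks = g hs ks)"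
  shows "P (The P)"
proof (rule theI'[of P])
  obtain f where "P f"
    unfolding P_def using cochain_exists[of s r g] assms(1) by metis
  show "\<exists>!f. P f"
  proof (rule ex1I[of P f])
    show "P f" by fact
    show "f' = f" if "P f'" for f'
      using that \<open>P f\<close> unfolding P_def by (intro cochain_eqI[of f' r s f]) auto
  qed
qed

section \<open>Shuffles and the bar differential\<close>

lemma alternate_0 [simp]: "alternate 0 y = y"
  by (simp add: alternate_def)

lemma alternate_Suc [simp]: "alternate (Suc n) y = - alternate n y"
  by (simp add: alternate_def)

lemma alternate_zero [simp]: "alternate n 0 = 0"
  by (simp add: alternate_def)

lemma alternate_uminus: "alternate n (- y) = - alternate n y"
  by (simp add: alternate_def)

lemma alternate_add: "alternate n (x + y) = alternate n x + alternate n y"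
  by (simp add: alternate_def)

lemma alternate_diff: "alternate n (x - y) = alternate n x - alternate n y"
  by (simp add: alternate_def)

lemma alternate_alternate: "alternate m (alternate n y) = alternate (m + n) y"
  by (simp add: alternate_def)

lemma alternate_sum: "alternate n (sum f A) = (\<Sum>x\<in>A. alternate n (f x))"
  by (simp add: alternate_def sum_negf)

lemma shuffle_eval_cong:
  assumes "\<And>w. length w = length ks \<Longrightarrow> g w = g' w"
  shows "shuffle_eval l g ks = shuffle_eval l g' ks"
  unfolding shuffle_eval_def by (simp add: assms)

lemma shuffle_eval_additive:
  fixes d :: "'a::ab_group_add \<Rightarrow> 'b::ab_group_add"
  assumes d: "\<And>x y. d (x + y) = d x + d y"
  shows "shuffle_eval l (\<lambda>w. d (g w)) ks = d (shuffle_eval l g ks)"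
proof -
  have 0: "d 0 = 0" using d[of 0 0] by simp
  have "d (- x) = - d x" for x
    using d[of x "- x"] by (simp add: 0 eq_neg_iff_add_eq_0 add.commute)
  then have "d (alternate n x) = alternate n (d x)" for n x
    by (simp add: alternate_def)
  moreover have "d (sum h A) = (\<Sum>a\<in>A. d (h a))" for h :: "(nat \<Rightarrow> nat) \<Rightarrow> 'a" and A
    by (induction A rule: infinite_finite_induct) (simp_all add: 0 d)
  ultimately show ?thesis
    by (simp add: shuffle_eval_def)
qed

lemma shuffle_eval_sum:
  "shuffle_eval l (\<lambda>w. \<Sum>a\<in>A. g a w) ks = (\<Sum>a\<in>A. shuffle_eval l (g a) ks)"
  unfolding shuffle_eval_def alternate_sum by (rule sum.swap)

text \<open>Relabelling entries commutes with permuting positions; this serves the horizontal face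
  that applies \<open>dot (hd hs)\<close> to every entry.\<close>

lemma shuffle_eval_map:
  "shuffle_eval l (\<lambda>w. g (map d w)) ks = shuffle_eval l g (map d ks)"
  unfolding shuffle_eval_def
proof (intro sum.cong)
  fix \<sigma> assume "\<sigma> \<in> shuffle_perms l (length (map d ks))"
  then have "inv_into UNIV \<sigma> permutes {..<length ks}"
    by (simp add: permutes_inv shuffle_perms_permutes)
  then have "inv_into UNIV \<sigma> i < length ks" if "i < length ks" for i
    using permutes_in_image[of "inv_into UNIV \<sigma>" "{..<length ks}" i] that by simp
  then have "map d (map (\<lambda>i. ks ! inv_into UNIV \<sigma> i) [0..<length ks])
      = map (\<lambda>i. map d ks ! inv_into UNIV \<sigma> i) [0..<length (map d ks)]"
    by simp
  then show "alternate (if evenperm \<sigma> then 0 else 1) (g (map d (map (\<lambda>i. ks ! inv_into UNIV \<sigma> i) [0..<length ks])))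
      = alternate (if evenperm \<sigma> then 0 else 1) (g (map (\<lambda>i. map d ks ! inv_into UNIV \<sigma> i) [0..<length (map d ks)]))"
    by (simp only:)
qed simp

text \<open>The signed shuffle product of two words, paired with the functional \<open>f\<close>.
  The first letter comes from either word; \<open>y\<close> moved ahead of \<open>x # xs\<close>
  passes \<open>Suc (length xs)\<close> letters.\<close>

fun shuf :: "('h list \<Rightarrow> 'i::ab_group_add) \<Rightarrow> 'h list \<Rightarrow> 'h list \<Rightarrow> 'i" where
  "shuf f [] ys = f ys"
| "shuf f (x # xs) [] = f (x # xs)"
| "shuf f (x # xs) (y # ys) =
     shuf (\<lambda>w. f (x # w)) xs (y # ys) + alternate (Suc (length xs)) (shuf (\<lambda>w. f (y # w)) (x # xs) ys)"

lemma shuf_Nil_right [simp]: "shuf f xs [] = f xs"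
  by (cases xs) auto

section \<open>Shuffle permutations and their recursion on the last position\<close>

lemma finite_shuffle_perms: "finite (shuffle_perms l s)"
  by (rule finite_subset[OF _ finite_permutations[of "{..<s}"]]) (auto simp: shuffle_perms_def)

lemma strict_mono_permutes_id:
  fixes \<sigma> :: "nat \<Rightarrow> nat"
  assumes "\<sigma> permutes {..<s}" "strict_mono_on {..<s} \<sigma>"
  shows "\<sigma> = id"
proof (rule permutes_natset_ge[OF assms(1)])
  have "i < s \<Longrightarrow> i \<le> \<sigma> i" for i
  proof (induction i)
    case (Suc i)
    then have "\<sigma> i < \<sigma> (Suc i)"
      by (intro strict_mono_onD[OF assms(2)]) auto
    with Suc show ?case by simp
  qed simp
  then show "\<forall>i\<in>{..<s}. i \<le> \<sigma> i" by simp
qed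

lemma shuffle_perms_trivial:
  "shuffle_perms 0 s = {id}" "shuffle_perms s s = {id}"
proof -
  have "shuffle_perms 0 s = {\<sigma>. \<sigma> permutes {..<s} \<and> strict_mono_on {..<s} \<sigma>}"
    "shuffle_perms s s = {\<sigma>. \<sigma> permutes {..<s} \<and> strict_mono_on {..<s} \<sigma>}"
    by (simp_all add: shuffle_perms_def atLeast0LessThan)
  moreover have "{\<sigma>. \<sigma> permutes {..<s} \<and> strict_mono_on {..<s} \<sigma>} = {id}"
  proof (intro equalityI subsetI)
    show "\<sigma> \<in> {\<sigma>. \<sigma> permutes {..<s} \<and> strict_mono_on {..<s} \<sigma>}" if "\<sigma> \<in> {id}" for \<sigma>
      using that permutes_id[of "{..<s}"] by (simp add: strict_mono_onI)
  qed (auto intro: strict_mono_permutes_id)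
  ultimately show "shuffle_perms 0 s = {id}" "shuffle_perms s s = {id}"
    by simp_all
qed

lemma shuffle_eval_trivial:
  "shuffle_eval 0 g hs = g hs" "shuffle_eval (length hs) g hs = g hs"
  by (simp_all add: shuffle_eval_def shuffle_perms_trivial map_nth)

text \<open>Since \<open>l \<le> s\<close>, position \<open>s\<close> lies outside the first block,
  and taking the maximal value there does not disturb the increase on the second.\<close>

lemma shuffle_perms_fixing_last:
  assumes "l \<le> s"
  shows "{\<sigma> \<in> shuffle_perms l (Suc s). \<sigma> s = s} = shuffle_perms l s"
proof (intro equalityI subsetI)
  fix \<sigma> assume *: "\<sigma> \<in> {\<sigma> \<in> shuffle_perms l (Suc s). \<sigma> s = s}"
  then have "\<sigma> permutes {..<s}"
    by (intro permutes_superset[OF shuffle_perms_permutes[of \<sigma> l "Suc s"]]) auto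
  moreover have "strict_mono_on {..<l} \<sigma>" "strict_mono_on {l..<Suc s} \<sigma>"
    using * by (auto simp: shuffle_perms_def)
  then have "strict_mono_on {..<l} \<sigma>" "strict_mono_on {l..<s} \<sigma>"
    by (auto intro: monotone_on_subset)
  ultimately show "\<sigma> \<in> shuffle_perms l s"
    by (simp add: shuffle_perms_def)
next
  fix \<sigma> assume *: "\<sigma> \<in> shuffle_perms l s"
  then have p: "\<sigma> permutes {..<s}" by (rule shuffle_perms_permutes)
  have fixed: "\<sigma> s = s" using p by (simp add: permutes_def)
  have "\<sigma> i < s" if "i < s" for i
    using permutes_in_image[OF p, of i] that by simp
  with * fixed have "strict_mono_on {l..<Suc s} \<sigma>"
    by (auto simp: shuffle_perms_def strict_mono_on_def less_Suc_eq)
  moreover have "\<sigma> permutes {..<Suc s}"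
    by (rule permutes_subset[OF p]) auto
  ultimately show "\<sigma> \<in> {\<sigma> \<in> shuffle_perms l (Suc s). \<sigma> s = s}"
    using * fixed by (simp add: shuffle_perms_def)
qed

text \<open>Composition with \<open>rot a s\<close> turns a shuffle that sends \<open>a\<close> to the last position \<open>s\<close> into one
  that fixes \<open>s\<close>, hence into a shuffle of \<open>{..<s}\<close>.\<close>

definition rot :: "nat \<Rightarrow> nat \<Rightarrow> nat \<Rightarrow> nat" where
  "rot a b i = (if a \<le> i \<and> i < b then Suc i else if i = b then a else i)"

definition rot_inv :: "nat \<Rightarrow> nat \<Rightarrow> nat \<Rightarrow> nat" where
  "rot_inv a b i = (if a < i \<and> i \<le> b then i - 1 else if i = a then b else i)"

lemma rot_rot_inv: "a \<le> b \<Longrightarrow> rot a b \<circ> rot_inv a b = id" "a \<le> b \<Longrightarrow> rot_inv a b \<circ> rot a b = id"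
  by (auto simp: fun_eq_iff rot_def rot_inv_def)

lemma rot_permutes: "a \<le> b \<Longrightarrow> rot a b permutes {..<Suc b}"
  by (rule bij_imp_permutes, rule bij_betw_byWitness[where f' = "rot_inv a b"])
    (auto simp: rot_def rot_inv_def)

lemma rot_inv_permutes:
  assumes "a \<le> b" shows "rot_inv a b permutes {..<Suc b}"
proof -
  have "inv_into UNIV (rot a b) = rot_inv a b"
    using rot_rot_inv[OF assms] by (intro inv_unique_comp)
  then show ?thesis
    using permutes_inv[OF rot_permutes[OF assms]] by simp
qed

text \<open>Lengthening the cycle by one position multiplies it by an adjacent
  transposition.\<close>

lemma evenperm_rot: "evenperm (rot a (a + k)) \<longleftrightarrow> even k"
proof (induction k)
  case 0
  have "rot a a = id" by (auto simp: rot_def)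
  then show ?case by simp
next
  case (Suc k)
  have "rot a (a + Suc k) = rot a (a + k) \<circ> transpose (a + k) (a + Suc k)"
    by (auto simp: fun_eq_iff rot_def transpose_def)
  moreover have "permutation (rot a (a + k))"
    by (rule permutation_permutes[THEN iffD2]) (use rot_permutes in \<open>blast intro: finite_lessThan le_add1\<close>)
  ultimately have "evenperm (rot a (a + Suc k)) \<longleftrightarrow>
      (evenperm (rot a (a + k)) \<longleftrightarrow> evenperm (transpose (a + k) (a + Suc k)))"
    by (simp only: evenperm_comp permutation_swap_id)
  with Suc show ?case
    by (simp add: evenperm_swap)
qed

lemma evenperm_comp_rot:
  assumes "\<sigma> permutes {..<Suc (a + k)}"
  shows "evenperm (\<sigma> \<circ> rot a (a + k)) \<longleftrightarrow> (evenperm \<sigma> \<longleftrightarrow> even k)"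
proof -
  have "permutation \<sigma>" "permutation (rot a (a + k))"
    using assms rot_permutes[of a "a + k"] by (auto simp: permutation_permutes)
  then show ?thesis by (simp only: evenperm_comp evenperm_rot)
qed

lemma comp_rot_shuffle:
  assumes "a < s" "\<sigma> \<in> shuffle_perms (Suc a) (Suc s)" "\<sigma> a = s"
  shows "\<sigma> \<circ> rot a s \<in> shuffle_perms a s"
proof -
  have p: "\<sigma> \<circ> rot a s permutes {..<Suc s}"
    using assms by (intro permutes_compose rot_permutes shuffle_perms_permutes) auto
  have "\<sigma> \<circ> rot a s permutes {..<s}"
    by (rule permutes_superset[OF p]) (use assms in \<open>auto simp: rot_def\<close>)
  moreover have "strict_mono_on {..<a} (\<sigma> \<circ> rot a s)"
    using assms by (auto simp: shuffle_perms_def strict_mono_on_def rot_def)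
  moreover have "strict_mono_on {a..<s} (\<sigma> \<circ> rot a s)"
    using assms by (auto simp: shuffle_perms_def strict_mono_on_def rot_def)
  ultimately show ?thesis by (simp add: shuffle_perms_def)
qed

lemma comp_rot_inv_shuffle:
  assumes "a < s" "\<tau> \<in> shuffle_perms a s"
  shows "\<tau> \<circ> rot_inv a s \<in> shuffle_perms (Suc a) (Suc s)" "(\<tau> \<circ> rot_inv a s) a = s"
proof -
  have \<tau>: "\<tau> permutes {..<s}" using assms(2) by (rule shuffle_perms_permutes)
  then have s: "\<tau> s = s" by (simp add: permutes_def)
  have less: "\<tau> i < s" if "i < s" for i
    using permutes_in_image[OF \<tau>, of i] that by simp
  have "\<tau> \<circ> rot_inv a s permutes {..<Suc s}"
    using assms by (intro permutes_compose rot_inv_permutes permutes_subset[OF \<tau>]) auto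
  moreover have "strict_mono_on {..<Suc a} (\<tau> \<circ> rot_inv a s)"
    using assms s less by (auto simp: shuffle_perms_def strict_mono_on_def rot_inv_def)
  moreover have "strict_mono_on {Suc a..<Suc s} (\<tau> \<circ> rot_inv a s)"
  proof (rule strict_mono_onI)
    fix i j assume ij: "i \<in> {Suc a..<Suc s}" "j \<in> {Suc a..<Suc s}" "i < j"
    have "strict_mono_on {a..<s} \<tau>" using assms(2) by (simp add: shuffle_perms_def)
    \<comment> \<open>On the second block \<open>rot_inv a s\<close> is the shift down by
      one.\<close>
    then have "\<tau> (i - 1) < \<tau> (j - 1)"
      by (rule strict_mono_onD) (use ij in auto)
    with ij show "(\<tau> \<circ> rot_inv a s) i < (\<tau> \<circ> rot_inv a s) j"
      by (simp add: rot_inv_def)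
  qed
  ultimately show "\<tau> \<circ> rot_inv a s \<in> shuffle_perms (Suc a) (Suc s)" by (simp add: shuffle_perms_def)
  show "(\<tau> \<circ> rot_inv a s) a = s" using assms s by (simp add: rot_inv_def)
qed

text \<open>The largest value \<open>s\<close> is attained, and an increasing map attains its
  maximum at the end of its block; the blocks end at \<open>a\<close> and at
  \<open>s\<close>.\<close>

lemma shuffle_perms_cases:
  assumes "a < s" "\<sigma> \<in> shuffle_perms (Suc a) (Suc s)"
  shows "\<sigma> s = s \<or> \<sigma> a = s"
proof -
  have p: "\<sigma> permutes {..<Suc s}" using assms(2) by (rule shuffle_perms_permutes)
  have mono: "strict_mono_on {..<Suc a} \<sigma>" "strict_mono_on {Suc a..<Suc s} \<sigma>"
    using assms by (auto simp: shuffle_perms_def)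
  have le: "\<sigma> i \<le> s" if "i \<le> s" for i
    using permutes_in_image[OF p, of i] that by simp
  have "s \<in> \<sigma> ` {..<Suc s}" using permutes_image[OF p] by simp
  then obtain j where j: "j \<le> s" "\<sigma> j = s"
    by (metis imageE lessThan_iff less_Suc_eq_le)
  have "j = a" if "j \<le> a"
  proof (rule ccontr)
    assume "j \<noteq> a"
    with that have "\<sigma> j < \<sigma> a" by (intro strict_mono_onD[OF mono(1)]) auto
    with j le[of a] assms show False by simp
  qed
  moreover have "j = s" if "\<not> j \<le> a"
  proof (rule ccontr)
    assume "j \<noteq> s"
    with that j have "\<sigma> j < \<sigma> s" by (intro strict_mono_onD[OF mono(2)]) auto
    with j le[of s] show False by simp
  qed
  ultimately show ?thesis using j by blast
qed

text \<open>Shuffles are sorted by the letter in the last place: \<open>y\<close> if \<sigma> fixes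
  the last position, \<open>x\<close> if it sends the end of the first block there. In the latter
  case moving \<open>x\<close> behind \<open>ys @ [y]\<close> costs \<open>Suc (length ys)\<close>
  transpositions.\<close>

lemma shuffle_eval_snoc:
  "shuffle_eval (Suc (length xs)) g (xs @ x # ys @ [y]) =
     shuffle_eval (Suc (length xs)) (\<lambda>w. g (w @ [y])) (xs @ x # ys)
     + alternate (Suc (length ys)) (shuffle_eval (length xs) (\<lambda>w. g (w @ [x])) (xs @ ys @ [y]))"
proof -
  let ?a = "length xs" and ?k = "Suc (length ys)"
  let ?s = "?a + ?k"
  let ?hs = "xs @ x # ys @ [y]"
  let ?t = "\<lambda>\<sigma>. alternate (if evenperm \<sigma> then 0 else 1) (g (map (\<lambda>i. ?hs ! inv_into UNIV \<sigma> i) [0..<Suc ?s]))"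
  let ?P = "shuffle_perms (Suc ?a) (Suc ?s)"
  let ?A = "{\<sigma>\<in>?P. \<sigma> ?s = ?s}" and ?B = "{\<sigma>\<in>?P. \<sigma> ?a = ?s}"
  have inj: "inj \<sigma>" if "\<sigma> \<in> ?P" for \<sigma>
    using permutes_inj[OF shuffle_perms_permutes[OF that]] .
  have "?P = ?A \<union> ?B" using shuffle_perms_cases[of ?a ?s] by auto
  moreover have "\<not> (\<sigma> ?s = ?s \<and> \<sigma> ?a = ?s)" if "\<sigma> \<in> ?P" for \<sigma>
    using injD[OF inj[OF that], of ?s ?a] by auto
  then have "?A \<inter> ?B = {}" by blast
  ultimately have "sum ?t ?P = sum ?t ?A + sum ?t ?B"
    using finite_shuffle_perms by (metis (no_types, lifting) finite_Un sum.union_disjoint)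
  moreover have "sum ?t ?A = shuffle_eval (Suc ?a) (\<lambda>w. g (w @ [y])) (xs @ x # ys)"
  proof -
    have "map (\<lambda>i. ?hs ! inv_into UNIV \<sigma> i) [0..<Suc ?s]
       = map (\<lambda>i. (xs @ x # ys) ! inv_into UNIV \<sigma> i) [0..<?s] @ [y]" if "\<sigma> \<in> shuffle_perms (Suc ?a) ?s" for \<sigma>
    proof -
      have p: "inv_into UNIV \<sigma> permutes {..<?s}"
        using shuffle_perms_permutes[OF that] by (rule permutes_inv)
      have "inv_into UNIV \<sigma> i < ?s" if "i < ?s" for i
        using permutes_in_image[OF p, of i] that by simp
      moreover have "inv_into UNIV \<sigma> ?s = ?s" using p by (simp add: permutes_def)
      moreover have "?hs ! i = (xs @ x # ys) ! i" if "i < ?s" for i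
        using that nth_append[of "xs @ x # ys" "[y]" i] by simp
      moreover have "?hs ! ?s = y" by (simp add: nth_append)
      ultimately show ?thesis by simp
    qed
    then show ?thesis
      by (simp add: shuffle_eval_def shuffle_perms_fixing_last del: upt_Suc)
  qed
  moreover have "sum ?t ?B = alternate ?k (shuffle_eval ?a (\<lambda>w. g (w @ [x])) (xs @ ys @ [y]))"
  proof -
    \<comment> \<open>Composing with \<open>rot\<close> takes \<open>x\<close> out of position
      \<open>?a\<close> and closes the gap; the letters read off in the first \<open>?s\<close>
      places stay the same.\<close>
    have eq: "map (\<lambda>i. ?hs ! inv_into UNIV \<sigma> i) [0..<Suc ?s]
       = map (\<lambda>i. (xs @ ys @ [y]) ! inv_into UNIV (\<sigma> \<circ> rot ?a ?s) i) [0..<?s] @ [x]" if "\<sigma> \<in> ?B" for \<sigma>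
    proof -
      have \<sigma>: "\<sigma> permutes {..<Suc ?s}" and \<sigma>a: "\<sigma> ?a = ?s"
        using that by (auto intro: shuffle_perms_permutes)
      have p: "inv_into UNIV (\<sigma> \<circ> rot ?a ?s) permutes {..<?s}"
        using that by (intro permutes_inv shuffle_perms_permutes[OF comp_rot_shuffle]) auto
      have "bij (rot ?a ?s)" "bij \<sigma>"
        using permutes_bij[OF rot_permutes[of ?a ?s]] permutes_bij[OF \<sigma>] by auto
      then have inv: "inv_into UNIV \<sigma> i = rot ?a ?s (inv_into UNIV (\<sigma> \<circ> rot ?a ?s) i)" for i
        by (simp add: o_inv_distrib surj_f_inv_f bij_is_surj)
      have lt: "inv_into UNIV (\<sigma> \<circ> rot ?a ?s) i < ?s" if "i < ?s" for i
        using permutes_in_image[OF p, of i] that by simp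
      have "?hs ! rot ?a ?s j = (xs @ ys @ [y]) ! j" if "j < ?s" for j
        using that by (auto simp: rot_def nth_append nth_Cons Suc_diff_le not_less split: nat.splits)
      with lt inv have "?hs ! inv_into UNIV \<sigma> i = (xs @ ys @ [y]) ! inv_into UNIV (\<sigma> \<circ> rot ?a ?s) i" if "i < ?s" for i
        using that by simp
      moreover have "inv_into UNIV \<sigma> ?s = ?a"
        using \<sigma>a permutes_inv_eq[OF \<sigma>] by metis
      ultimately show ?thesis by (simp add: nth_append)
    qed
    have "sum ?t ?B = (\<Sum>\<tau>\<in>shuffle_perms ?a ?s. alternate ?k (alternate (if evenperm \<tau> then 0 else 1)
        (g (map (\<lambda>i. (xs @ ys @ [y]) ! inv_into UNIV \<tau> i) [0..<?s] @ [x]))))"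
    proof (rule sum.reindex_bij_witness[of _ "\<lambda>\<tau>. \<tau> \<circ> rot_inv ?a ?s" "\<lambda>\<sigma>. \<sigma> \<circ> rot ?a ?s"])
      fix \<sigma> assume \<sigma>: "\<sigma> \<in> ?B"
      show "(\<sigma> \<circ> rot ?a ?s) \<circ> rot_inv ?a ?s = \<sigma>"
        by (simp add: comp_assoc rot_rot_inv)
      show "\<sigma> \<circ> rot ?a ?s \<in> shuffle_perms ?a ?s"
        using \<sigma> by (intro comp_rot_shuffle) auto
      have "\<sigma> permutes {..<Suc ?s}" using \<sigma> by (auto intro: shuffle_perms_permutes)
      from evenperm_comp_rot[OF this]
      show "alternate ?k (alternate (if evenperm (\<sigma> \<circ> rot ?a ?s) then 0 else 1)
        (g (map (\<lambda>i. (xs @ ys @ [y]) ! inv_into UNIV (\<sigma> \<circ> rot ?a ?s) i) [0..<?s] @ [x]))) = ?t \<sigma>"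
        unfolding eq[OF \<sigma>] by (simp add: alternate_def del: upt_Suc)
    next
      fix \<tau> assume \<tau>: "\<tau> \<in> shuffle_perms ?a ?s"
      show "(\<tau> \<circ> rot_inv ?a ?s) \<circ> rot ?a ?s = \<tau>"
        by (simp add: comp_assoc rot_rot_inv)
      show "\<tau> \<circ> rot_inv ?a ?s \<in> ?B"
        using comp_rot_inv_shuffle[OF _ \<tau>] by simp
    qed
    then show ?thesis
      by (simp add: shuffle_eval_def alternate_sum)
  qed
  moreover have "shuffle_eval (Suc ?a) g ?hs = sum ?t ?P"
    by (simp add: shuffle_eval_def)
  ultimately show ?thesis by simp
qed

text \<open>Permutations of an initial segment restrict well when the last position is fixed, not the
  first; this is why the lists are reversed.\<close>

lemma shuffle_eval_eq_shuf_rev: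
  "shuffle_eval (length xs) (\<lambda>w. f (rev w)) (rev xs @ rev ys) = shuf f ys xs"
proof (induction f ys xs rule: shuf.induct)
  case (1 f xs)
  then show ?case using shuffle_eval_trivial(2)[of "rev xs" "\<lambda>w. f (rev w)"] by simp
next
  case (2 f y ys)
  then show ?case by (simp add: shuffle_eval_trivial(1))
next
  \<comment> \<open>The words appear in swapped order: \<open>y\<close> ends the second block of the
    reversed word, and the summand where it stays last has no sign, as for the leading letter of the
    first argument of \<open>shuf\<close>.\<close>
  case (3 f y ys x xs)
  then show ?case
    using shuffle_eval_snoc[of "rev xs" "\<lambda>w. f (rev w)" x "rev ys" y] by simp
qed

lemma shuffle_eval_eq_shuf:
  "shuffle_eval (length xs) f (xs @ ys) = shuf (\<lambda>w. f (rev w)) (rev ys) (rev xs)"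
  using shuffle_eval_eq_shuf_rev[of "rev xs" "\<lambda>w. f (rev w)" "rev ys"] by simp

section \<open>The bar differential and the shuffle product\<close>

lemma shuf_add: "shuf (\<lambda>w. f w + g w) xs ys = shuf f xs ys + shuf g xs ys"
proof (induction f xs ys arbitrary: g rule: shuf.induct)
  case (3 f x xs y ys)
  then show ?case by (simp add: alternate_add)
qed auto

lemma shuf_uminus: "shuf (\<lambda>w. - f w) xs ys = - shuf f xs ys"
proof (induction f xs ys rule: shuf.induct)
  case (3 f x xs y ys)
  then show ?case by (simp add: alternate_uminus)
qed auto

lemma shuf_diff: "shuf (\<lambda>w. f w - g w) xs ys = shuf f xs ys - shuf g xs ys"
  using shuf_add[of f "\<lambda>w. - g w"] by (simp add: shuf_uminus)

text \<open>Dual of a bar differential: adjacent letters are multiplied by the commutative rule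
  \<open>[x] + [y] - [x + y]\<close>, which is how the elements \<open>1 - x\<close> of a group ring
  multiply. Successive products alternate in sign, starting with plus.\<close>

fun bar :: "('h::ab_group_add list \<Rightarrow> 'i::ab_group_add) \<Rightarrow> 'h list \<Rightarrow> 'i" where
  "bar f [] = 0"
| "bar f [x] = 0"
| "bar f (x # y # zs) = f (x # zs) + f (y # zs) - f ((x + y) # zs) - bar (\<lambda>w. f (x # w)) (y # zs)"

text \<open>\<open>bar\<close> evaluates its functional on nonempty words one letter shorter.
  Nonemptiness matters in \<open>shuf_bar_eq_0\<close>, where nothing is known about shuffles with
  an empty word.\<close>

lemma bar_cong:
  assumes "\<And>u. u \<noteq> [] \<Longrightarrow> Suc (length u) = length xs \<Longrightarrow> f u = g u"
  shows "bar f xs = bar g xs"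
  using assms
proof (induction f xs arbitrary: g rule: bar.induct)
  case (3 f x y zs)
  have "bar (\<lambda>w. f (x # w)) (y # zs) = bar (\<lambda>w. g (x # w)) (y # zs)"
    by (rule 3(1)) (simp add: 3(2))
  then show ?case by (simp add: 3(2))
qed auto

lemma bar_add: "bar (\<lambda>w. f w + g w) xs = bar f xs + bar g xs"
proof (induction f xs arbitrary: g rule: bar.induct)
  case (3 f x y zs)
  then show ?case by simp
qed auto

lemma bar_uminus: "bar (\<lambda>w. - f w) xs = - bar f xs"
proof (induction f xs rule: bar.induct)
  case (3 f x y zs)
  then show ?case by simp
qed auto

lemma bar_diff: "bar (\<lambda>w. f w - g w) xs = bar f xs - bar g xs"
  using bar_add[of f "\<lambda>w. - g w"] by (simp add: bar_uminus)

lemma bar_alternate: "bar (\<lambda>w. alternate n (f w)) xs = alternate n (bar f xs)"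
  by (simp add: alternate_def bar_uminus)

text \<open>One letter is lost under \<open>bar\<close>, so the sign seen by \<open>f\<close> has
  exponent \<open>length xs - 1\<close>.\<close>

lemma bar_alternate_length:
  "bar (\<lambda>w. alternate (length w) (f w)) xs = - alternate (length xs) (bar f xs)"
proof (cases xs)
  case (Cons x zs)
  have "bar (\<lambda>w. alternate (length w) (f w)) xs = bar (\<lambda>w. alternate (length zs) (f w)) xs"
    by (rule bar_cong) (simp add: Cons)
  then show ?thesis by (simp add: bar_alternate Cons)
qed simp

lemma shuf_Cons_right:
  "shuf h xs (y # ys) =
     (case xs of [] \<Rightarrow> 0 | x # xs' \<Rightarrow> shuf (\<lambda>w. h (x # w)) xs' (y # ys))
     + alternate (length xs) (shuf (\<lambda>w. h (y # w)) xs ys)"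
  by (cases xs) auto

lemma shuf_Cons_left:
  "shuf h (x # xs) ys =
     shuf (\<lambda>w. h (x # w)) xs ys +
     (case ys of [] \<Rightarrow> 0 | y # ys' \<Rightarrow> alternate (Suc (length xs)) (shuf (\<lambda>w. h (y # w)) (x # xs) ys'))"
  by (cases ys) auto

definition first_merge :: "'h::ab_group_add \<Rightarrow> ('h list \<Rightarrow> 'i::ab_group_add) \<Rightarrow> 'h list \<Rightarrow> 'i" where
  "first_merge x f w = (case w of [] \<Rightarrow> 0 | y # zs \<Rightarrow> f (x # zs) + f (y # zs) - f ((x + y) # zs))"

lemma first_merge_simps [simp]:
  "first_merge x f [] = 0"
  "first_merge x f (y # zs) = f (x # zs) + f (y # zs) - f ((x + y) # zs)"
  by (simp_all add: first_merge_def)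

lemma bar_Cons: "bar f (x # w) = first_merge x f w - bar (\<lambda>w. f (x # w)) w"
  by (cases w) simp_all

text \<open>Dual form of the derivation rule. Products within one word give the right-hand side; a
  letter of \<open>xs\<close> next to a letter of \<open>ys\<close> occurs in both orders, with
  equal products and opposite signs.\<close>

lemma shuf_bar:
  "shuf (bar f) xs ys = bar (\<lambda>u. shuf f u ys) xs + alternate (length xs) (bar (shuf f xs) ys)"
proof (induction f xs ys rule: shuf.induct)
  case (3 f x xs y ys)
  let ?n = "length xs"
  let ?fx = "\<lambda>w. f (x # w)" and ?fy = "\<lambda>w. f (y # w)" and ?fxy = "\<lambda>w. f ((x + y) # w)"
  \<comment> \<open>\<open>T\<close> collects the products of \<open>x\<close> with
    \<open>y\<close>, \<open>X\<close> those of \<open>x\<close> with the next letter of its own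
    word, and \<open>Y\<close> likewise for \<open>y\<close>; the remaining letters are
    shuffled.\<close>
  define T where "T = shuf ?fx xs ys + shuf ?fy xs ys - shuf ?fxy xs ys"
  define X where "X = (case xs of [] \<Rightarrow> 0 | x' # xs' \<Rightarrow>
    shuf ?fx xs' (y # ys) + shuf (\<lambda>w. f (x' # w)) xs' (y # ys) - shuf (\<lambda>w. f ((x + x') # w)) xs' (y # ys))"
  define Y where "Y = (case ys of [] \<Rightarrow> 0 | y' # ys' \<Rightarrow>
    shuf ?fy (x # xs) ys' + shuf (\<lambda>w. f (y' # w)) (x # xs) ys' - shuf (\<lambda>w. f ((y + y') # w)) (x # xs) ys')"
  have mx: "shuf (first_merge x f) xs (y # ys) = X + alternate ?n T"
    by (simp add: shuf_Cons_right[of "first_merge x f"] X_def T_def shuf_add shuf_diff split: list.split)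
  \<comment> \<open>The product now arises as that of \<open>y\<close> with \<open>x\<close>;
    commutativity of addition identifies it with \<open>T\<close>.\<close>
  have my: "shuf (first_merge y f) (x # xs) ys = T - alternate ?n Y"
    by (simp add: shuf_Cons_left[of "first_merge y f"] Y_def T_def shuf_add shuf_diff add.commute split: list.split)
  \<comment> \<open>\<open>T\<close> enters with the signs \<open>alternate ?n\<close> and
    \<open>- alternate ?n\<close> and cancels.\<close>
  have 1: "shuf (bar f) (x # xs) (y # ys) = X + alternate ?n T - shuf (bar ?fx) xs (y # ys)
      - alternate ?n (T - alternate ?n Y - shuf (bar ?fy) (x # xs) ys)"
    by (simp add: bar_Cons[abs_def] shuf_diff mx my)
  have 2: "bar (\<lambda>u. shuf f u (y # ys)) (x # xs) =
     X - bar (\<lambda>u. shuf ?fx u (y # ys)) xs + alternate ?n (bar (\<lambda>u. shuf ?fy u ys) (x # xs))"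
  proof -
    have "first_merge x (\<lambda>u. shuf f u (y # ys)) xs = X + alternate ?n (first_merge x (\<lambda>u. shuf ?fy u ys) xs)"
      by (cases xs) (simp_all add: X_def alternate_def)
    moreover have "bar (\<lambda>w. shuf f (x # w) (y # ys)) xs
        = bar (\<lambda>u. shuf ?fx u (y # ys)) xs + alternate ?n (bar (\<lambda>w. shuf ?fy (x # w) ys) xs)"
      by (simp add: bar_add bar_uminus bar_diff bar_alternate_length)
    ultimately show ?thesis
      by (simp add: bar_Cons alternate_def)
  qed
  have 3: "bar (shuf f (x # xs)) (y # ys) =
     bar (shuf ?fx xs) (y # ys) - alternate ?n Y + alternate ?n (bar (shuf ?fy (x # xs)) ys)"
  proof -
    have "first_merge y (shuf f (x # xs)) ys = first_merge y (shuf ?fx xs) ys - alternate ?n Y"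
      by (cases ys) (simp_all add: Y_def alternate_def)
    moreover have "bar (\<lambda>v. shuf f (x # xs) (y # v)) ys
        = bar (\<lambda>v. shuf ?fx xs (y # v)) ys - alternate ?n (bar (shuf ?fy (x # xs)) ys)"
      by (simp add: bar_diff bar_alternate)
    ultimately show ?thesis
      by (simp add: bar_Cons)
  qed
  show ?case
    unfolding 1 2 3 "3.IH" by (cases "even ?n") (simp_all add: alternate_def)
qed simp_all

text \<open>By \<open>shuf_bar\<close> both terms apply \<open>bar\<close> to a function that
  vanishes on all the words \<open>bar\<close> evaluates.\<close>

lemma shuf_bar_eq_0:
  assumes f: "\<And>us vs. us \<noteq> [] \<Longrightarrow> vs \<noteq> [] \<Longrightarrow> length us + length vs = n \<Longrightarrow> shuf f us vs = 0"
    and "xs \<noteq> []" "ys \<noteq> []" "length xs + length ys = Suc n"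
  shows "shuf (bar f) xs ys = 0"
proof -
  have zero: "bar (\<lambda>_. 0) zs = 0" for zs :: "'a list"
    using bar_diff[of "\<lambda>_. 0" "\<lambda>_. 0" zs] by simp
  have "bar (\<lambda>u. shuf f u ys) xs = bar (\<lambda>_. 0) xs"
    by (rule bar_cong) (use assms in simp)
  moreover have "bar (shuf f xs) ys = bar (\<lambda>_. 0) ys"
    by (rule bar_cong) (use assms in simp)
  ultimately show ?thesis
    by (simp add: shuf_bar zero)
qed

section \<open>The bar differential as an alternating sum of faces\<close>

lemma merge_snoc: "1 \<le> j \<Longrightarrow> j < length ks \<Longrightarrow> merge j (ks @ [x]) = merge j ks @ [x]" for ks :: "'h::ab_group_add list"
  by (simp add: merge_def nth_append less_imp_diff_less)

text \<open>In \<open>bar\<close> an inner letter is omitted by the two products it enters, with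
  opposite signs. What remains are the merges and the omissions of the two outer letters; the global
  sign comes from reversing the word.\<close>

lemma bar_eq_alternating_sum:
  "length ks = Suc s \<Longrightarrow>
    f (tl ks) + (\<Sum>j = 1..s. alternate j (f (merge j ks))) + alternate (Suc s) (f (take s ks))
      = alternate (Suc s) (bar (\<lambda>w. f (rev w)) (rev ks))"
proof (induction s arbitrary: f ks)
  case 0
  then show ?case by (auto simp: length_Suc_conv)
next
  case (Suc s)
  \<comment> \<open>The last two letters are exposed because they lead \<open>rev ks\<close>, where
    \<open>bar\<close> recurses.\<close>
  obtain us y x where ks: "ks = us @ [y, x]" and us: "length us = s"
  proof -
    from Suc.prems obtain vs x where "ks = vs @ [x]" "length vs = Suc s"
      by (metis length_append_singleton list.size(3) nat.distinct(1) nat.inject rev_exhaust)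
    moreover then obtain us y where "vs = us @ [y]" "length us = s"
      by (metis length_append_singleton list.size(3) nat.distinct(1) nat.inject rev_exhaust)
    ultimately show thesis using that by simp
  qed
  let ?f = "\<lambda>w. f (w @ [x])" and ?vs = "us @ [y]"
  have "(\<Sum>j = 1..s. alternate j (f (merge j ks))) = (\<Sum>j = 1..s. alternate j (?f (merge j ?vs)))"
    using merge_snoc[of _ ?vs x] us by (intro sum.cong) (auto simp: ks)
  moreover have "merge (Suc s) ks = us @ [y + x]"
    by (simp add: ks us merge_def nth_append flip: us)
  moreover have "tl ks = tl ?vs @ [x]" by (cases us) (simp_all add: ks)
  moreover have "take (Suc s) ks = ?vs" "take s ?vs = us" by (simp_all add: ks us)
  ultimately show ?case
    using Suc.IH[of ?vs ?f] by (simp add: ks us algebra_simps alternate_add alternate_def split: if_splits)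
qed

section \<open>Faces\<close>

lemma presimplicial_double_sum:
  fixes F :: "nat \<Rightarrow> nat \<Rightarrow> 'i::ab_group_add"
  assumes F: "\<And>i j. i < j \<Longrightarrow> j \<le> Suc n \<Longrightarrow> F j i = F i (j - 1)"
  shows "(\<Sum>j\<le>Suc n. alternate j (\<Sum>i\<le>n. alternate i (F j i))) = 0"
proof -
  let ?t = "\<lambda>(j, i). alternate (j + i) (F j i)"
  let ?A = "{(j, i). i < j \<and> j \<le> Suc n}" and ?B = "{(j, i). j \<le> i \<and> i \<le> n}"
  have fin: "finite ({..Suc n} \<times> {..n})" by simp
  have AB: "{..Suc n} \<times> {..n} = ?A \<union> ?B" "?A \<inter> ?B = {}" by auto
  have "(\<Sum>j\<le>Suc n. alternate j (\<Sum>i\<le>n. alternate i (F j i))) = sum ?t ({..Suc n} \<times> {..n})"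
    by (simp add: alternate_sum alternate_alternate sum.cartesian_product del: sum.atMost_Suc)
  also have "\<dots> = sum ?t ?A + sum ?t ?B"
    using fin unfolding AB(1) by (intro sum.union_disjoint) (auto simp: AB(2))
  \<comment> \<open>The pair \<open>(j, i)\<close> with \<open>i < j\<close> goes to
    \<open>(i, j - 1)\<close>: equal value by \<open>F\<close>, and an exponent lower by
    one.\<close>
  also have "sum ?t ?A = (\<Sum>p\<in>?B. - ?t p)"
    by (rule sum.reindex_bij_witness[of _ "\<lambda>(j, i). (Suc i, j)" "\<lambda>(j, i). (i, j - 1)"])
      (auto simp: F alternate_def)
  finally show ?thesis
    by (simp add: sum_negf)
qed

text \<open>Meant for normalization: a zero at list index \<open>p\<close> can disappear in the
  faces \<open>p\<close> and \<open>Suc p\<close> alone.\<close>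

lemma alternating_sum_adjacent:
  fixes a :: "nat \<Rightarrow> 'i::ab_group_add"
  assumes "p < n" "a p = a (Suc p)" "\<And>j. j \<le> n \<Longrightarrow> j \<noteq> p \<Longrightarrow> j \<noteq> Suc p \<Longrightarrow> a j = 0"
  shows "(\<Sum>j\<le>n. alternate j (a j)) = 0"
proof -
  have "(\<Sum>j\<le>n. alternate j (a j)) = (\<Sum>j\<in>{p, Suc p}. alternate j (a j))"
    by (rule sum.mono_neutral_right) (use assms in auto)
  then show ?thesis using assms(2) by simp
qed

text \<open>One family for all summands: the first index drops the first entry, the index
  \<open>length ks\<close> drops the last, those between merge. The pointwise form lets identities
  be checked entry by entry.\<close>

definition face :: "nat \<Rightarrow> 'h::ab_group_add list \<Rightarrow> 'h list" where
  "face j ks = map (\<lambda>p. if Suc p < j then ks ! p else if Suc p = j then ks ! p + ks ! Suc p else ks ! Suc p)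
     [0..<length ks - 1]"

lemma length_face [simp]: "length (face j ks) = length ks - 1"
  by (simp add: face_def)

lemma nth_face:
  "p < length ks - 1 \<Longrightarrow> face j ks ! p =
     (if Suc p < j then ks ! p else if Suc p = j then ks ! p + ks ! Suc p else ks ! Suc p)"
  by (simp add: face_def)

lemma face_0: "face 0 ks = tl ks"
  by (rule nth_equalityI) (simp_all add: nth_face nth_tl)

lemma face_length: "face (length ks) ks = take (length ks - 1) ks"
  by (rule nth_equalityI) (auto simp: nth_face)

lemma face_eq_merge:
  assumes "1 \<le> j" "j < length ks"
  shows "face j ks = merge j ks"
proof (rule nth_equalityI)
  fix p assume "p < length (face j ks)"
  with assms show "face j ks ! p = merge j ks ! p"
    by (cases "p < j - 1"; cases "p = j - 1")
      (auto simp: nth_face merge_def nth_append nth_Cons min_def Suc_diff_le split: nat.splits)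
qed (use assms in \<open>auto simp: merge_def\<close>)

text \<open>Entrywise this shifts indices, except that for \<open>j = Suc i\<close> two inner faces
  form a sum of three neighbours in two bracketings.\<close>

lemma face_face:
  assumes "i < j" "j \<le> length ks"
  shows "face i (face j ks) = face (j - 1) (face i ks)"
  by (rule nth_equalityI) (use assms in \<open>auto simp: nth_face add.assoc\<close>)

lemma face_map:
  assumes "\<And>a b. d (a + b) = d a + d b"
  shows "face j (map d ks) = map d (face j ks)"
  by (rule nth_equalityI) (auto simp: nth_face assms)

lemma alternating_face_sum:
  assumes "length ks = Suc s"
  shows "(\<Sum>j\<le>Suc s. alternate j (g (face j ks)))
    = g (tl ks) + (\<Sum>j = 1..s. alternate j (g (merge j ks))) + alternate (Suc s) (g (take s ks))"
proof -
  have "(\<Sum>j\<le>s. alternate j (g (face j ks))) = g (face 0 ks) + (\<Sum>j = 1..s. alternate j (g (face j ks)))"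
    by (simp add: atMost_atLeast0 sum.atLeast_Suc_atMost)
  moreover have "(\<Sum>j = 1..s. alternate j (g (face j ks))) = (\<Sum>j = 1..s. alternate j (g (merge j ks)))"
    using assms by (intro sum.cong) (auto simp: face_eq_merge)
  moreover have "face (Suc s) ks = take s ks"
    using face_length[of ks] assms by simp
  ultimately show ?thesis by (simp add: face_0)
qed

lemma face_append: "face (Suc (length us)) (us @ a # b # vs) = us @ (a + b) # vs"
  by (subst face_eq_merge) (simp_all add: merge_def nth_append)

lemma zero_in_face:
  assumes "p < length ks" "ks ! p = 0" "j \<noteq> p" "j \<noteq> Suc p" "j \<le> length ks"
  shows "0 \<in> set (face j ks)"
proof (cases "j < p")
  case True
  then have "face j ks ! (p - 1) = 0" "p - 1 < length (face j ks)"
    using assms by (auto simp: nth_face)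
  then show ?thesis by (metis nth_mem)
next
  case False
  then have "face j ks ! p = 0" "p < length (face j ks)"
    using assms by (auto simp: nth_face)
  then show ?thesis by (metis nth_mem)
qed

text \<open>Adding a zero to its left or right neighbour, or dropping it at an end, just deletes
  it.\<close>

lemma face_eq_face_Suc:
  assumes "p < length ks" "ks ! p = 0"
  shows "face p ks = face (Suc p) ks"
  by (rule nth_equalityI) (use assms in \<open>auto simp: nth_face less_Suc_eq\<close>)

section \<open>The vertical coboundary\<close>

text \<open>Shifting the summation index by \<open>r\<close> extracts the common factor
  \<open>(-1)^r\<close>.\<close>

lemma dv_formula_eq:
  assumes "length ks = Suc s"
  shows "dv_formula r s f hs ks = alternate r (\<Sum>j\<le>Suc s. alternate j (cochain_val f hs (face j ks)))"
proof -
  have "(\<Sum>j = r + 1..r + s. alternate j (cochain_val f hs (merge (j - r) ks)))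
      = (\<Sum>j = 1..s. alternate r (alternate j (cochain_val f hs (merge j ks))))"
    using sum.shift_bounds_cl_nat_ivl[of "\<lambda>j. alternate j (cochain_val f hs (merge (j - r) ks))" 1 r s]
    by (simp add: alternate_alternate add.commute)
  then show ?thesis
    unfolding alternating_face_sum[of ks s "cochain_val f hs", OF assms] dv_formula_def
    by (simp add: alternate_add alternate_diff alternate_sum alternate_alternate del: sum.cl_ivl_Suc)
qed

text \<open>The two faces at a zero of \<open>ks\<close> agree and have opposite signs; every other
  summand still contains a zero.\<close>

lemma dv_formula_zero:
  assumes "length ks = Suc s" "0 \<in> set hs \<union> set ks"
  shows "dv_formula r s f hs ks = 0"
proof (cases "0 \<in> set hs")
  case True
  then show ?thesis
    by (simp add: dv_formula_eq assms cochain_val_zero del: sum.atMost_Suc)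
next
  case False
  with assms obtain p where p: "p < length ks" "ks ! p = 0"
    by (auto simp: in_set_conv_nth)
  have "(\<Sum>j\<le>Suc s. alternate j (cochain_val f hs (face j ks))) = 0"
    by (rule alternating_sum_adjacent[of p])
      (use p assms face_eq_face_Suc[OF p] zero_in_face[OF p] in \<open>auto intro!: cochain_val_zero\<close>)
  then show ?thesis by (simp only: dv_formula_eq[OF assms(1)] alternate_zero)
qed

text \<open>Up to reversal and sign the formula is \<open>bar\<close> of the cochain, which itself
  kills shuffles of two nonempty words.\<close>

lemma shuffle_eval_dv_formula:
  fixes f :: "('h::ab_group_add, 'i::ab_group_add) cochain"
  assumes f: "f \<in> carrier (cochains r s)" and hs: "length hs = r" and ks: "length ks = Suc s"
    and l: "1 \<le> l" "l < Suc s"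
  shows "shuffle_eval l (dv_formula r s f hs) ks = 0"
proof -
  \<comment> \<open>Reversal matches both \<open>shuffle_eval_eq_shuf_rev\<close> and
    \<open>bar_eq_alternating_sum\<close>.\<close>
  define F where "F w = cochain_val f hs (rev w)" for w
  define xs ys where "xs = take l ks" and "ys = drop l ks"
  have xy: "ks = xs @ ys" "length xs = l" "length ys = Suc s - l"
    using ks l by (auto simp: xs_def ys_def)
  have "shuf F us vs = 0" if "us \<noteq> []" "vs \<noteq> []" "length us + length vs = s" for us vs
  proof -
    have "1 \<le> length vs" "length vs < s"
      using that by (cases us; cases vs; auto)+
    then have "shuffle_eval (length vs) (cochain_val f hs) (rev vs @ rev us) = 0"
      using that by (intro shuffle_eval_cochain_val[OF f hs]) auto
    then show ?thesis
      using shuffle_eval_eq_shuf_rev[of vs F us] by (simp add: F_def)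
  qed
  then have 0: "shuf (bar F) (rev ys) (rev xs) = 0"
    by (rule shuf_bar_eq_0) (use xy l in auto)
  have "dv_formula r s f hs w = alternate (r + Suc s) (bar F (rev w))" if "length w = length ks" for w
    unfolding dv_formula_eq[OF that[unfolded ks]] alternating_face_sum[OF that[unfolded ks]]
      bar_eq_alternating_sum[OF that[unfolded ks]]
    by (simp only: F_def[abs_def] alternate_alternate)
  then have "shuffle_eval l (dv_formula r s f hs) ks
     = shuffle_eval l (\<lambda>w. alternate (r + Suc s) (bar F (rev w))) ks"
    by (rule shuffle_eval_cong)
  also have "\<dots> = alternate (r + Suc s) (shuffle_eval l (\<lambda>w. bar F (rev w)) ks)"
    by (rule shuffle_eval_additive[OF alternate_add])
  also have "shuffle_eval l (\<lambda>w. bar F (rev w)) ks = 0"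
    using shuffle_eval_eq_shuf[of xs "\<lambda>w. bar F (rev w)" ys] 0 by (simp add: xy)
  finally show ?thesis by simp
qed

text \<open>The values are recorded also for lists with zeros, since the faces in an iterated
  coboundary may contain them.\<close>

lemma dv_spec:
  fixes f :: "('h::ab_group_add, 'i::ab_group_add) cochain"
  assumes f: "f \<in> carrier (cochains r s)"
  shows dv_carrier: "dv r s f \<in> carrier (cochains r (Suc s))"
    and cochain_val_dv: "length hs = r \<Longrightarrow> length ks = Suc s \<Longrightarrow> cochain_val (dv r s f) hs ks = dv_formula r s f hs ks"
proof -
  have *: "dv r s f \<in> carrier (cochains r (s + 1)) \<and>
     (\<forall>hs\<in>tuples r. \<forall>ks\<in>tuples (s + 1). cochain_val (dv r s f) hs ks = dv_formula r s f hs ks)"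
    unfolding dv_def
    by (rule cochain_the_spec, rule shuffle_eval_dv_formula[OF f]) (simp_all add: tuples_def)
  then show "dv r s f \<in> carrier (cochains r (Suc s))" by simp
  show "cochain_val (dv r s f) hs ks = dv_formula r s f hs ks" if "length hs = r" "length ks = Suc s"
  proof (cases "0 \<in> set hs \<union> set ks")
    case True
    then show ?thesis by (simp only: cochain_val_zero dv_formula_zero[OF that(2)])
  qed (use * that in \<open>auto simp: tuples_def\<close>)
qed

lemma dv_hom: "(dv r s :: ('h::ab_group_add, 'i::ab_group_add) cochain \<Rightarrow> _) \<in> hom (cochains r s) (cochains r (Suc s))"
proof (rule homI)
  interpret C: comm_group "cochains r s :: ('h, 'i) cochain monoid" by (rule comm_group_cochains)
  interpret C': comm_group "cochains r (Suc s) :: ('h, 'i) cochain monoid" by (rule comm_group_cochains)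
  fix f f' :: "('h, 'i) cochain" assume f: "f \<in> carrier (cochains r s)" "f' \<in> carrier (cochains r s)"
  show "dv r s (f \<otimes>\<^bsub>cochains r s\<^esub> f') = dv r s f \<otimes>\<^bsub>cochains r (Suc s)\<^esub> dv r s f'"
  proof (rule cochain_eqI)
    fix hs ks :: "'h list" assume "hs \<in> tuples r" "ks \<in> tuples (Suc s)"
    then have "length hs = r" "length ks = Suc s" by (auto simp: tuples_def)
    then show "cochain_val (dv r s (f \<otimes>\<^bsub>cochains r s\<^esub> f')) hs ks
        = cochain_val (dv r s f \<otimes>\<^bsub>cochains r (Suc s)\<^esub> dv r s f') hs ks"
      using f by (simp add: cochain_val_dv cochain_val_mult dv_formula_eq alternate_add sum.distrib del: sum.atMost_Suc)
  qed (use f in \<open>auto intro: dv_carrier\<close>)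
qed (rule dv_carrier)

lemma dv_dv:
  fixes f :: "('h::ab_group_add, 'i::ab_group_add) cochain"
  assumes f: "f \<in> carrier (cochains r s)"
  shows "dv r (Suc s) (dv r s f) = \<one>\<^bsub>cochains r (Suc (Suc s))\<^esub>"
proof (rule cochain_eqI)
  interpret comm_group "cochains r (Suc (Suc s)) :: ('h, 'i) cochain monoid" by (rule comm_group_cochains)
  show "\<one>\<^bsub>cochains r (Suc (Suc s))\<^esub> \<in> carrier (cochains r (Suc (Suc s)) :: ('h, 'i) cochain monoid)"
    by simp
  show "dv r (Suc s) (dv r s f) \<in> carrier (cochains r (Suc (Suc s)))"
    by (intro dv_carrier f)
  fix hs ks :: "'h list" assume t: "hs \<in> tuples r" "ks \<in> tuples (Suc (Suc s))"
  then have l: "length hs = r" "length ks = Suc (Suc s)" by (auto simp: tuples_def)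
  have "cochain_val (dv r (Suc s) (dv r s f)) hs ks
      = alternate r (\<Sum>j\<le>Suc (Suc s). alternate j (alternate r
          (\<Sum>i\<le>Suc s. alternate i (cochain_val f hs (face i (face j ks))))))"
    using l by (simp add: cochain_val_dv dv_carrier f dv_formula_eq del: sum.atMost_Suc)
  also have "\<dots> = alternate r (alternate r (\<Sum>j\<le>Suc (Suc s). alternate j
          (\<Sum>i\<le>Suc s. alternate i (cochain_val f hs (face i (face j ks))))))"
    by (simp only: alternate_sum alternate_alternate add.commute add.left_commute)
  also have "\<dots> = 0"
    using l by (subst presimplicial_double_sum) (simp_all add: face_face)
  finally show "cochain_val (dv r (Suc s) (dv r s f)) hs ks = cochain_val \<one>\<^bsub>cochains r (Suc (Suc s))\<^esub> hs ks"
    by (simp add: cochain_val_one[OF t])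
qed


section \<open>The horizontal coboundary\<close>

context linear_cycle_set
begin

lemma dot_zero_right [simp]: "dot a 0 = 0"
  using dot_add_right[of a 0 0] by simp

lemma dot_eq_iff [simp]: "dot a b = dot a c \<longleftrightarrow> b = c"
  using bij_dot[of a] by (meson bij_is_inj injD)

text \<open>\<open>dot_add_left\<close> gives \<open>dot 0 c = dot 0 (dot 0 c)\<close>, and
  \<open>dot 0\<close> is injective.\<close>

lemma dot_zero_left [simp]: "dot 0 c = c"
  using dot_add_left[of 0 0 c] by simp

lemma dot_sum_list: "dot a (sum_list hs) = sum_list (map (dot a) hs)"
  by (induction hs) (simp_all add: dot_add_right)

text \<open>The inverse in \<open>lcs_mult\<close> undoes \<open>dot a\<close>. This translates the
  module axiom into addition.\<close>

lemma lcs_mult_dot: "lcs_mult dot a (dot a b) = a + b"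
proof -
  have "inj (dot a)" by (simp add: inj_def)
  then show ?thesis by (simp add: lcs_mult_def add.commute)
qed

end

section \<open>Modules over a linear cycle set and the horizontal faces\<close>

locale lcs_action = linear_cycle_set dot for dot :: "'h::ab_group_add \<Rightarrow> 'h \<Rightarrow> 'h" +
  fixes act :: "'h \<Rightarrow> 'i::ab_group_add \<Rightarrow> 'i"
  assumes act_mult: "act (lcs_mult dot h' h) y = act h (act h' y)"
    and act_add: "act h (y + y') = act h y + act h y'"
    and act_0 [simp]: "act 0 y = y"
begin

lemma act_zero [simp]: "act h 0 = 0"
  using act_add[of h 0 0] by simp

lemma act_uminus: "act h (- y) = - act h y"
  using act_add[of h y "- y"] by (metis act_zero add.right_inverse minus_unique)

lemma act_alternate: "act h (alternate n y) = alternate n (act h y)"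
  by (simp add: alternate_def act_uminus)

lemma act_sum: "act h (sum f A) = (\<Sum>a\<in>A. act h (f a))"
  by (induction A rule: infinite_finite_induct) (simp_all add: act_add)

text \<open>An operator on functions rather than on tuples, because the last face acts on the value;
  the first face moves both tuples at once.\<close>

definition hface :: "nat \<Rightarrow> ('h list \<Rightarrow> 'h list \<Rightarrow> 'i) \<Rightarrow> 'h list \<Rightarrow> 'h list \<Rightarrow> 'i" where
  "hface j g hs ks =
     (if j = 0 then g (map (dot (hd hs)) (tl hs)) (map (dot (hd hs)) ks)
      else if j = length hs then act (dot (sum_list (butlast hs)) (last hs)) (g (face j hs) ks)
      else g (face j hs) ks)"

lemma hface_cong:
  assumes "\<And>us vs. length us = length hs - 1 \<Longrightarrow> length vs = length ks \<Longrightarrow> g us vs = g' us vs"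
  shows "hface j g hs ks = hface j g' hs ks"
  by (simp add: hface_def assms)

lemma hface_add: "hface j (\<lambda>us vs. g us vs + g' us vs) hs ks = hface j g hs ks + hface j g' hs ks"
  by (simp add: hface_def act_add)

lemma hface_alternate: "hface j (\<lambda>us vs. alternate n (g us vs)) hs ks = alternate n (hface j g hs ks)"
  by (simp add: hface_def act_alternate)

lemma hface_sum: "hface j (\<lambda>us vs. \<Sum>a\<in>A. g a us vs) hs ks = (\<Sum>a\<in>A. hface j (g a) hs ks)"
  by (simp add: hface_def act_sum)

text \<open>\<open>dot (hd hs)\<close> is additive, hence commutes with merging entries of
  \<open>ks\<close>; this makes the two directions compatible.\<close>

lemma hface_face: "hface i (\<lambda>us vs. g us (face j vs)) hs ks = hface i g hs (face j ks)"
  by (simp add: hface_def face_map dot_add_right)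

lemma hface_hface:
  assumes ij: "i < j" "j \<le> length hs" and hs: "2 \<le> length hs"
  shows "hface j (hface i g) hs ks = hface i (hface (j - 1) g) hs ks"
proof (cases "i = 0")
  case i: True
  from hs obtain h1 h2 zs where hs': "hs = h1 # h2 # zs"
    by (cases hs; cases "tl hs") auto
  show ?thesis
  proof (cases "j = 1")
    case True
    \<comment> \<open>Moving by \<open>h1\<close> and then by the new head \<open>dot h1 h2\<close>
      is moving by \<open>h1 + h2\<close>.\<close>
    have "dot (h1 + h2) = (\<lambda>x. dot (dot h1 h2) (dot h1 x))"
      by (simp add: fun_eq_iff dot_add_left)
    with True face_append[of "[]" h1 h2 zs] show ?thesis
      by (simp add: hface_def i hs' o_def)
  next
    case False
    with ij have j: "2 \<le> j" by simp
    have tl: "tl (face j hs) = face (j - 1) (tl hs)"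
      using face_face[of 0 j hs] ij by (simp add: face_0)
    have hd: "hd (face j hs) = hd hs"
      using j nth_face[of 0 hs j] by (simp add: hd_conv_nth hs' flip: length_greater_0_conv)
    have m: "face (j - 1) (map (dot h1) (tl hs)) = map (dot h1) (tl (face j hs))"
      by (simp add: tl face_map dot_add_right)
    \<comment> \<open>Splitting \<open>h1\<close> off the sum by \<open>dot_add_left\<close> shows
      that the first face leaves the coefficient of the last face unchanged.\<close>
    have "dot (sum_list (butlast hs)) (last hs)
        = dot (sum_list (butlast (map (dot h1) (tl hs)))) (last (map (dot h1) (tl hs)))"
      by (simp add: hs' dot_add_left dot_sum_list map_butlast last_map)
    with j hd m show ?thesis
      by (auto simp: hface_def i hs')
  qed
next
  case i: False
  show ?thesis
  proof (cases "j < length hs")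
    case True
    then show ?thesis
      using i ij face_face[OF ij] by (auto simp: hface_def)
  next
    case False
    with ij have j: "j = length hs" by simp
    define us where "us = take (i - 1) hs"
    \<comment> \<open>The list is opened at the two entries that face \<open>i\<close> merges, at
      list indices \<open>i - 1\<close> and \<open>i\<close>.\<close>
    have "hs = us @ hs ! (i - 1) # hs ! i # drop (Suc i) hs"
      using i ij j id_take_nth_drop[of "i - 1" hs] Cons_nth_drop_Suc[of i hs] by (simp add: us_def)
    then obtain a b vs where hs': "hs = us @ a # b # vs" by blast
    have us: "i = Suc (length us)"
      using i ij by (simp add: us_def)
    have fi: "face i hs = us @ (a + b) # vs"
      using face_append[of us a b vs] by (simp add: us hs')
    have ff: "face i (face j hs) = face (j - 1) (face i hs)"
      using ij by (rule face_face)
    show ?thesis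
    proof (cases "vs = []")
      case True
      have fj: "face j hs = us @ [a]"
        using face_length[of hs] by (simp add: j hs' True)
      \<comment> \<open>Put \<open>u = dot S a\<close> and \<open>v = dot S b\<close> with
        \<open>S = sum_list us\<close>. The outer coefficient is \<open>dot u v\<close>, and
        \<open>act_mult\<close> combines both into \<open>lcs_mult dot u (dot u v)\<close>, which is
        \<open>u + v\<close>.\<close>
      have "act (dot (sum_list us + a) b) (act (dot (sum_list us) a) y) = act (dot (sum_list us) (a + b)) y" for y
        by (simp add: dot_add_left dot_add_right lcs_mult_dot flip: act_mult)
      moreover have "hface j (hface i g) hs ks = act (dot (sum_list us + a) b) (hface i g (us @ [a]) ks)"
        using fj j unfolding hface_def[of j] by (simp add: hs' True butlast_append)
      moreover have "hface i g (us @ [a]) ks = act (dot (sum_list us) a) (g (face i (us @ [a])) ks)"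
        by (simp add: hface_def us)
      moreover have "hface i (hface (j - 1) g) hs ks = hface (j - 1) g (us @ [a + b]) ks"
        using fi us unfolding hface_def[of i] by (simp add: hs' True)
      moreover have "hface (j - 1) g (us @ [a + b]) ks = act (dot (sum_list us) (a + b)) (g (face (j - 1) (us @ [a + b])) ks)"
        by (simp add: hface_def j hs' True)
      ultimately show ?thesis
        using ff by (simp add: fi fj True)
    next
      case False
      have "hface j (hface i g) hs ks
          = act (dot (sum_list (butlast hs)) (last hs)) (g (face i (face j hs)) ks)"
        using False by (simp add: hface_def j us) (simp add: hs')
      moreover have "hface i (hface (j - 1) g) hs ks
          = act (dot (sum_list (butlast (face i hs))) (last (face i hs))) (g (face (j - 1) (face i hs)) ks)"
        using False by (simp add: hface_def j us) (simp add: hs')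
      \<comment> \<open>The merge leaves the last entry alone and preserves the sum of the others,
        so the coefficients agree.\<close>
      ultimately show ?thesis
        using ff False by (simp add: fi) (simp add: hs' butlast_append add.assoc)
    qed
  qed
qed

lemma dh_formula_eq:
  assumes "length hs = Suc r"
  shows "dh_formula dot act r f hs ks = (\<Sum>j\<le>Suc r. alternate j (hface j (cochain_val f) hs ks))"
proof -
  let ?t = "\<lambda>j. alternate j (hface j (cochain_val f) hs ks)"
  have ne: "hs \<noteq> []" using assms by auto
  have "(\<Sum>j\<le>r. ?t j) = ?t 0 + (\<Sum>j = 1..r. ?t j)"
    by (simp add: atMost_atLeast0 sum.atLeast_Suc_atMost)
  moreover have "(\<Sum>j = 1..r. ?t j) = (\<Sum>j = 1..r. alternate j (cochain_val f (merge j hs) ks))"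
    using assms by (intro sum.cong) (auto simp: face_eq_merge hface_def)
  moreover have "face (Suc r) hs = take r hs"
    using face_length[of hs] assms by simp
  moreover have "dot (sum_list (butlast hs)) (last hs) = R1 dot r hs"
    using assms ne by (simp add: R1_def butlast_conv_take last_conv_nth)
  ultimately show ?thesis
    using assms by (simp add: dh_formula_def hface_def)
qed

lemma hface_zero:
  assumes g: "\<And>us vs. 0 \<in> set us \<union> set vs \<Longrightarrow> g us vs = 0"
    and 0: "0 \<in> set (face j hs) \<union> set ks"
  shows "hface j g hs ks = 0"
proof -
  \<comment> \<open>\<open>dot a\<close> fixes \<open>0\<close>, so zero entries persist under the
    first face.\<close>
  have "0 \<in> set (map (dot a) xs)" if "0 \<in> set xs" for a xs
    using that by (force intro: image_eqI[of _ _ 0])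
  then have "g (map (dot (hd hs)) (tl hs)) (map (dot (hd hs)) ks) = 0" if "j = 0"
    using 0 that by (intro g) (auto simp: face_0 simp del: set_map)
  moreover have "g (face j hs) ks = 0"
    using 0 by (rule g)
  ultimately show ?thesis
    by (auto simp: hface_def)
qed

lemma dh_formula_zero:
  assumes hs: "length hs = Suc r" and 0: "0 \<in> set hs \<union> set ks"
  shows "dh_formula dot act r f hs ks = 0"
proof -
  let ?g = "cochain_val f"
  have z: "hface j ?g hs ks = 0" if "0 \<in> set (face j hs) \<union> set ks" for j
    by (rule hface_zero[OF _ that]) (rule cochain_val_zero)
  show ?thesis
  proof (cases "0 \<in> set ks")
    case True
    then show ?thesis by (simp add: dh_formula_eq hs z del: sum.atMost_Suc)
  next
    case False
    with 0 obtain p where p: "p < length hs" "hs ! p = 0"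
      by (auto simp: in_set_conv_nth)
    have ne: "hs \<noteq> []" using hs by auto
    \<comment> \<open>With a zero in the last place the coefficient is \<open>0\<close>, which acts
      trivially, so the last face is untwisted.\<close>
    have last: "dot (sum_list (butlast hs)) (last hs) = 0" if "Suc p = length hs"
    proof -
      have "length hs - 1 = p" using that by simp
      then show ?thesis using p ne by (simp add: last_conv_nth)
    qed
    \<comment> \<open>With a zero in the first place the first face moves by \<open>dot 0\<close>,
      the identity.\<close>
    have map0: "map (dot 0) xs = xs" for xs by (simp add: map_idI)
    have eq: "hface p ?g hs ks = hface (Suc p) ?g hs ks"
      using p ne last face_eq_face_Suc[OF p] by (auto simp: hface_def hd_conv_nth map0 face_0)
    have "(\<Sum>j\<le>Suc r. alternate j (hface j ?g hs ks)) = 0"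
      by (rule alternating_sum_adjacent[of p])
        (use p hs eq zero_in_face[OF p] in \<open>auto intro!: z\<close>)
    then show ?thesis by (simp only: dh_formula_eq[OF hs])
  qed
qed

text \<open>Each horizontal face relabels the letters of \<open>ks\<close>, applies an additive map
  to the value, or leaves \<open>ks\<close> alone; all three preserve vanishing on shuffles.\<close>

lemma shuffle_eval_dh_formula:
  assumes f: "f \<in> carrier (cochains r s :: ('h, 'i) cochain monoid)"
    and hs: "length hs = Suc r" and ks: "length ks = s" and l: "1 \<le> l" "l < s"
  shows "shuffle_eval l (dh_formula dot act r f hs) ks = 0"
proof -
  let ?g = "cochain_val f"
  have g: "shuffle_eval l (?g us) vs = 0" if "length us = r" "length vs = s" for us vs
    by (rule shuffle_eval_cochain_val[OF f that l])
  have "shuffle_eval l (hface j ?g hs) ks = 0" for j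
  proof -
    consider "j = 0" | "j \<noteq> 0" "j = length hs" | "j \<noteq> 0" "j \<noteq> length hs" by blast
    then show ?thesis
    proof cases
      case 1
      then show ?thesis
        using shuffle_eval_map[of l "?g (map (dot (hd hs)) (tl hs))" "dot (hd hs)" ks] hs ks
        by (simp add: hface_def[abs_def] g)
    next
      case 2
      then show ?thesis
        using shuffle_eval_additive[of "act (dot (sum_list (butlast hs)) (last hs))" l "?g (face j hs)" ks] hs ks
        by (simp add: hface_def[abs_def] act_add g)
    next
      case 3
      then show ?thesis
        using hs ks by (simp add: hface_def[abs_def] g)
    qed
  qed
  then show ?thesis
    by (simp add: dh_formula_eq[OF hs, abs_def] shuffle_eval_sum
        shuffle_eval_additive[of "alternate n" for n, OF alternate_add] del: sum.atMost_Suc)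
qed

lemma dh_spec:
  assumes f: "f \<in> carrier (cochains r s :: ('h, 'i) cochain monoid)"
  shows dh_carrier: "dh dot act r s f \<in> carrier (cochains (Suc r) s)"
    and cochain_val_dh: "length hs = Suc r \<Longrightarrow> length ks = s \<Longrightarrow>
      cochain_val (dh dot act r s f) hs ks = dh_formula dot act r f hs ks"
proof -
  have *: "dh dot act r s f \<in> carrier (cochains (r + 1) s) \<and>
     (\<forall>hs\<in>tuples (r + 1). \<forall>ks\<in>tuples s. cochain_val (dh dot act r s f) hs ks = dh_formula dot act r f hs ks)"
    unfolding dh_def
    by (rule cochain_the_spec, rule shuffle_eval_dh_formula[OF f]) (simp_all add: tuples_def)
  then show "dh dot act r s f \<in> carrier (cochains (Suc r) s)" by simp
  show "cochain_val (dh dot act r s f) hs ks = dh_formula dot act r f hs ks" if "length hs = Suc r" "length ks = s"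
  proof (cases "0 \<in> set hs \<union> set ks")
    case True
    then show ?thesis by (simp only: cochain_val_zero dh_formula_zero[OF that(1)])
  qed (use * that in \<open>auto simp: tuples_def\<close>)
qed

lemma dh_hom: "dh dot act r s \<in> hom (cochains r s) (cochains (Suc r) s)"
proof (rule homI)
  interpret C: comm_group "cochains r s :: ('h, 'i) cochain monoid" by (rule comm_group_cochains)
  interpret C': comm_group "cochains (Suc r) s :: ('h, 'i) cochain monoid" by (rule comm_group_cochains)
  fix f f' :: "('h, 'i) cochain" assume f: "f \<in> carrier (cochains r s)" "f' \<in> carrier (cochains r s)"
  show "dh dot act r s (f \<otimes>\<^bsub>cochains r s\<^esub> f') = dh dot act r s f \<otimes>\<^bsub>cochains (Suc r) s\<^esub> dh dot act r s f'"
  proof (rule cochain_eqI)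
    fix hs ks :: "'h list" assume "hs \<in> tuples (Suc r)" "ks \<in> tuples s"
    then have l: "length hs = Suc r" "length ks = s" by (auto simp: tuples_def)
    have "hface j (cochain_val (f \<otimes>\<^bsub>cochains r s\<^esub> f')) hs ks
        = hface j (cochain_val f) hs ks + hface j (cochain_val f') hs ks" for j
      unfolding hface_add[symmetric] using l by (intro hface_cong) (simp add: cochain_val_mult)
    with l f show "cochain_val (dh dot act r s (f \<otimes>\<^bsub>cochains r s\<^esub> f')) hs ks
        = cochain_val (dh dot act r s f \<otimes>\<^bsub>cochains (Suc r) s\<^esub> dh dot act r s f') hs ks"
      by (simp add: cochain_val_dh cochain_val_mult dh_formula_eq alternate_add sum.distrib del: sum.atMost_Suc)
  qed (use f in \<open>auto intro: dh_carrier\<close>)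
qed (rule dh_carrier)

lemma dh_dh:
  assumes f: "f \<in> carrier (cochains r s :: ('h, 'i) cochain monoid)"
  shows "dh dot act (Suc r) s (dh dot act r s f) = \<one>\<^bsub>cochains (Suc (Suc r)) s\<^esub>"
proof (rule cochain_eqI)
  interpret comm_group "cochains (Suc (Suc r)) s :: ('h, 'i) cochain monoid" by (rule comm_group_cochains)
  show "\<one>\<^bsub>cochains (Suc (Suc r)) s\<^esub> \<in> carrier (cochains (Suc (Suc r)) s :: ('h, 'i) cochain monoid)"
    by simp
  show "dh dot act (Suc r) s (dh dot act r s f) \<in> carrier (cochains (Suc (Suc r)) s)"
    by (intro dh_carrier f)
  fix hs ks :: "'h list" assume t: "hs \<in> tuples (Suc (Suc r))" "ks \<in> tuples s"
  then have l: "length hs = Suc (Suc r)" "length ks = s" by (auto simp: tuples_def)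
  \<comment> \<open>\<open>hface_cong\<close> compares the functions on all lists of the right
    lengths, so the values of \<open>dh\<close> at lists with zeros are needed here.\<close>
  have "hface j (cochain_val (dh dot act r s f)) hs ks
      = (\<Sum>i\<le>Suc r. alternate i (hface j (hface i (cochain_val f)) hs ks))" for j
  proof -
    have "hface j (cochain_val (dh dot act r s f)) hs ks
        = hface j (\<lambda>us vs. \<Sum>i\<le>Suc r. alternate i (hface i (cochain_val f) us vs)) hs ks"
      using l by (intro hface_cong) (simp add: cochain_val_dh f dh_formula_eq del: sum.atMost_Suc)
    then show ?thesis by (simp only: hface_sum hface_alternate)
  qed
  then have "cochain_val (dh dot act (Suc r) s (dh dot act r s f)) hs ks
      = (\<Sum>j\<le>Suc (Suc r). alternate j (\<Sum>i\<le>Suc r. alternate i (hface j (hface i (cochain_val f)) hs ks)))"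
    using l by (simp only: cochain_val_dh dh_carrier f dh_formula_eq)
  also have "\<dots> = 0"
    using l by (intro presimplicial_double_sum hface_hface) auto
  finally show "cochain_val (dh dot act (Suc r) s (dh dot act r s f)) hs ks
      = cochain_val \<one>\<^bsub>cochains (Suc (Suc r)) s\<^esub> hs ks"
    by (simp add: cochain_val_one[OF t])
qed

text \<open>Both composites are one double sum over commuting horizontal and vertical faces. The
  vertical coboundary contributes \<open>(-1)^(r+1)\<close> after the horizontal one and
  \<open>(-1)^r\<close> before it.\<close>

lemma dv_dh:
  assumes f: "f \<in> carrier (cochains r s :: ('h, 'i) cochain monoid)"
  shows "dv (Suc r) s (dh dot act r s f) = inv\<^bsub>cochains (Suc r) (Suc s)\<^esub> (dh dot act r (Suc s) (dv r s f))"
proof -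
  interpret comm_group "cochains (Suc r) (Suc s) :: ('h, 'i) cochain monoid" by (rule comm_group_cochains)
  have c: "dv (Suc r) s (dh dot act r s f) \<in> carrier (cochains (Suc r) (Suc s))"
    "dh dot act r (Suc s) (dv r s f) \<in> carrier (cochains (Suc r) (Suc s))"
    by (intro dv_carrier dh_carrier f)+
  have "dv (Suc r) s (dh dot act r s f) \<otimes>\<^bsub>cochains (Suc r) (Suc s)\<^esub> dh dot act r (Suc s) (dv r s f)
      = \<one>\<^bsub>cochains (Suc r) (Suc s)\<^esub>"
  proof (rule cochain_eqI)
    fix hs ks :: "'h list" assume t: "hs \<in> tuples (Suc r)" "ks \<in> tuples (Suc s)"
    then have l: "length hs = Suc r" "length ks = Suc s" by (auto simp: tuples_def)
    define F where "F i j = hface i (cochain_val f) hs (face j ks)" for i j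
    have "cochain_val (dv (Suc r) s (dh dot act r s f)) hs ks
        = alternate (Suc r) (\<Sum>j\<le>Suc s. alternate j (\<Sum>i\<le>Suc r. alternate i (F i j)))"
      using l by (simp add: cochain_val_dv cochain_val_dh dh_carrier f dv_formula_eq dh_formula_eq F_def
          del: sum.atMost_Suc)
    also have "\<dots> = - (\<Sum>i\<le>Suc r. \<Sum>j\<le>Suc s. alternate (r + (i + j)) (F i j))"
      by (subst sum.swap) (simp add: alternate_sum alternate_alternate sum_negf add.commute add.left_commute
          del: sum.atMost_Suc)
    also have "(\<Sum>i\<le>Suc r. \<Sum>j\<le>Suc s. alternate (r + (i + j)) (F i j))
        = cochain_val (dh dot act r (Suc s) (dv r s f)) hs ks"
    proof -
      have "hface i (cochain_val (dv r s f)) hs ks = alternate r (\<Sum>j\<le>Suc s. alternate j (F i j))" for i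
      proof -
        have "hface i (cochain_val (dv r s f)) hs ks
            = hface i (\<lambda>us vs. alternate r (\<Sum>j\<le>Suc s. alternate j (cochain_val f us (face j vs)))) hs ks"
          using l by (intro hface_cong) (simp add: cochain_val_dv f dv_formula_eq del: sum.atMost_Suc)
        then show ?thesis by (simp only: F_def hface_sum hface_alternate hface_face)
      qed
      with l show ?thesis
        by (simp add: cochain_val_dh dv_carrier f dh_formula_eq alternate_sum alternate_alternate
            add.commute add.left_commute del: sum.atMost_Suc)
    qed
    finally show "cochain_val (dv (Suc r) s (dh dot act r s f) \<otimes>\<^bsub>cochains (Suc r) (Suc s)\<^esub>
        dh dot act r (Suc s) (dv r s f)) hs ks = cochain_val \<one>\<^bsub>cochains (Suc r) (Suc s)\<^esub> hs ks"
      using l by (simp add: cochain_val_mult cochain_val_one[OF t])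
  qed (use c in auto)
  then show ?thesis
    using c by (intro inv_equality[symmetric])
qed

end

text \<open>The first block of the conclusion supplies the existence that the definite descriptions
  leave open; the second then speaks about the intended maps.\<close>

theorem theorem5p1:
  fixes dot :: "'h::ab_group_add \<Rightarrow> 'h \<Rightarrow> 'h"
    and act :: "'h \<Rightarrow> 'i::ab_group_add \<Rightarrow> 'i"
  assumes "linear_cycle_set dot"
    and "\<And>h h' y. act (lcs_mult dot h' h) y = act h (act h' y)"
    and "\<And>h y y'. act h (y + y') = act h y + act h y'"
    and "\<And>y. act 0 y = y"
  shows
    "(\<forall>r s. 1 \<le> s \<longrightarrow>
       comm_group (cochains r s :: ('h, 'i) cochain monoid) \<and>
       dh dot act r s \<in> hom (cochains r s) (cochains (r + 1) s) \<and>
       (dv r s :: ('h, 'i) cochain \<Rightarrow> ('h, 'i) cochain) \<in> hom (cochains r s) (cochains r (s + 1)) \<and>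
       (\<forall>f\<in>carrier (cochains r s :: ('h, 'i) cochain monoid).
          (\<forall>hs\<in>tuples (r + 1). \<forall>ks\<in>tuples s.
             cochain_val (dh dot act r s f) hs ks = dh_formula dot act r f hs ks) \<and>
          (\<forall>hs\<in>tuples r. \<forall>ks\<in>tuples (s + 1).
             cochain_val (dv r s f) hs ks = dv_formula r s f hs ks))) \<and>
     (\<forall>r s. 1 \<le> s \<longrightarrow>
       (\<forall>f\<in>carrier (cochains r s :: ('h, 'i) cochain monoid).
          dv r (s + 1) (dv r s f) = \<one>\<^bsub>cochains r (s + 2)\<^esub> \<and>
          dh dot act (r + 1) s (dh dot act r s f) = \<one>\<^bsub>cochains (r + 2) s\<^esub> \<and>
          dv (r + 1) s (dh dot act r s f) =
            inv\<^bsub>cochains (r + 1) (s + 1)\<^esub> (dh dot act r (s + 1) (dv r s f))))"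
proof -
  interpret lcs_action dot act
    using assms by (simp add: lcs_action_def lcs_action_axioms_def)
  show ?thesis
    by (auto simp: comm_group_cochains dv_hom dh_hom dv_dv dh_dh dv_dh tuples_def
        intro!: cochain_val_dh cochain_val_dv)
qed

end
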